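(* Let $C=\{C^n\}_{n\in\mathbb N}$ be a pre-operad over $K$, let $\mu\in C^2$, and let $\smile=\smile_\mu$ and $\delta=\delta_\mu$ be the associated cup-multiplication and pre-coboundary operator. Then for all homogeneous $h\in C^h$, $f\in C^f$, $g\in C^g$ one has \[ (-1)^{|g|}\,\mathrm{dev}_{\{\cdot,\cdot,\cdot\}}\delta\,(h\otimes f\otimes g)=(h\bullet f)\smile g+(-1)^{|h|f}\,f\smile(h\bullet g)-h\bullet(f\smile g). \]
   Context: $K$ is a unital commutative associative ring, $\otimes=\otimes_K$, $\mathbb N$ contains $0$. For a homogeneous element $f\in C^n$ the degree $n$ is also written $f$ (in exponents of $-1$, in indices and in ranges), so $C^f=C^n$, $(-1)^f=(-1)^n$, $\circ_f=\circ_n$; the shifted degree is $|f|:=n-1$. Empty sums are $0$, and $C^n:=0$ for $n<0$. A (linear, right) pre-operad over $K$ is a sequence $C=\{C^n\}_{n\in\mathbb N}$ of unital $K$-modules with: (1) for $0\le i\le m-1$, $K$-linear partial compositions $\circ_i: C^m\otimes C^n\to C^{m+n-1}$; (2) for all $h\otimes f\otimes g\in C^h\otimes C^f\otimes C^g$, and $0\le i\le |h|$, $0\le j\le |f|+|h|$, \[ (h\circ_i f)\circ_j g=\begin{cases}(-1)^{|f||g|}(h\circ_j g)\circ_{i+|g|}f & \text{if } 0\le j\le i-1,\\ h\circ_i(f\circ_{j-i}g) & \text{if } i\le j\le i+|f|,\\ (-1)^{|f||g|}(h\circ_{j-|f|}g)\circ_i f & \text{if } i+f\le j\le |h|+|f|;\end{cases}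 \] (3) a unit $\mathrm I\in C^1$ with $\mathrm I\circ_0 f=f=f\circ_i\mathrm I$ for $0\le i\le |f|$. No associativity condition on $\mu$ is assumed. For $\mu\in C^2$ the cup-multiplication is $f\smile g:=(-1)^f(\mu\circ_0 f)\circ_f g\in C^{f+g}$. The total composition is $f\bullet g:=\sum_{i=0}^{|f|}f\circ_i g\in C^{f+g-1}$. The pre-coboundary operator $\delta=\delta_\mu$ is defined by $-\delta f:=f\bullet\mu-(-1)^{|f|}\mu\bullet f$. The tribraces are \[ \{h,f,g\}:=\sum_{i=0}^{|h|-1}\ \sum_{j=i+f}^{|f|+|h|}(h\circ_i f)\circ_j g\in C^{h+f+g-2}. \] The derivation deviation of $\delta$ over the tribraces is \[ \mathrm{dev}_{\{\cdot,\cdot,\cdot\}}\delta\,(h\otimes f\otimes g):=\delta\{h,f,g\}-\{h,f,\delta g\}-(-1)^{|g|}\{h,\delta f,g\}-(-1)^{|g|+|f|}\{\delta h,f,g\}. \] *)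

theory Defs
  imports "HOL-Algebra.Module"
begin

text \<open>
  The data of a pre-operad: the modules \<open>C\<^sup>n\<close>, the partial compositions, and the unit.
  The value \<open>circ P m n i h f\<close> is \<open>h \<circ>\<^sub>i f\<close> for \<open>h \<in> C\<^sup>m\<close>, \<open>f \<in> C\<^sup>n\<close>.  Degrees are explicit
  arguments throughout, since the carriers of the different \<open>C\<^sup>n\<close> are not required to be disjoint.
\<close>

record ('k, 'a) pre_operad_data =
  comp_mod :: "nat \<Rightarrow> ('k, 'a) module"
  circ :: "nat \<Rightarrow> nat \<Rightarrow> nat \<Rightarrow> 'a \<Rightarrow> 'a \<Rightarrow> 'a"
  unit_elem :: 'a

text \<open>\<open>signed M n x\<close> is \<open>(-1)\<^sup>n x\<close>; the exponent is an integer because \<open>\<bar>f\<bar> = -1\<close> in degree 0.\<close>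

definition signed :: "('k, 'a, 'm) module_scheme \<Rightarrow> int \<Rightarrow> 'a \<Rightarrow> 'a" where
  "signed M n x = (if even n then x else \<ominus>\<^bsub>M\<^esub> x)"

text \<open>A \<open>K\<close>-linear map \<open>M \<otimes>\<^sub>K N \<rightarrow> L\<close>, given as a \<open>K\<close>-bilinear map on \<open>M \<times> N\<close>.\<close>

definition bilinear_map ::
  "('k, 'r) ring_scheme \<Rightarrow> ('k, 'a, 'm) module_scheme \<Rightarrow> ('k, 'b, 'n) module_scheme \<Rightarrow>
    ('k, 'c, 'l) module_scheme \<Rightarrow> ('a \<Rightarrow> 'b \<Rightarrow> 'c) \<Rightarrow> bool" where
  "bilinear_map K M N L b \<longleftrightarrow>
    (\<forall>x \<in> carrier M. \<forall>y \<in> carrier N. b x y \<in> carrier L) \<and>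
    (\<forall>x \<in> carrier M. \<forall>x' \<in> carrier M. \<forall>y \<in> carrier N.
      b (x \<oplus>\<^bsub>M\<^esub> x') y = b x y \<oplus>\<^bsub>L\<^esub> b x' y) \<and>
    (\<forall>x \<in> carrier M. \<forall>y \<in> carrier N. \<forall>y' \<in> carrier N.
      b x (y \<oplus>\<^bsub>N\<^esub> y') = b x y \<oplus>\<^bsub>L\<^esub> b x y') \<and>
    (\<forall>a \<in> carrier K. \<forall>x \<in> carrier M. \<forall>y \<in> carrier N.
      b (a \<odot>\<^bsub>M\<^esub> x) y = a \<odot>\<^bsub>L\<^esub> b x y \<and> b x (a \<odot>\<^bsub>N\<^esub> y) = a \<odot>\<^bsub>L\<^esub> b x y)"

text \<open>
  The range conditions make every truncated subtraction below exact: \<open>i < m\<close> gives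
  \<open>m + n \<ge> 1\<close>, \<open>j < i\<close> gives \<open>i + g \<ge> 1\<close>, and \<open>i + f \<le> j\<close> gives \<open>f \<le> j + 1\<close>.
  Further, \<open>i < h\<close> is \<open>0 \<le> i \<le> \<bar>h\<bar>\<close>, and \<open>j < h + f - 1\<close> is \<open>0 \<le> j \<le> \<bar>f\<bar> + \<bar>h\<bar>\<close>.
\<close>

locale pre_operad =
  fixes K :: "('k, 'r) ring_scheme" and P :: "('k, 'a) pre_operad_data"
  assumes base_ring: "cring K"
    and modules: "\<And>n. module K (comp_mod P n)"
    and circ_bilinear: "\<And>m n i. i < m \<Longrightarrow>
      bilinear_map K (comp_mod P m) (comp_mod P n) (comp_mod P (m + n - 1)) (circ P m n i)"
    and circ_left: "\<And>h f g i j x y z.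
      \<lbrakk>x \<in> carrier (comp_mod P h); y \<in> carrier (comp_mod P f); z \<in> carrier (comp_mod P g);
        i < h; j < h + f - 1; j < i\<rbrakk> \<Longrightarrow>
      circ P (h + f - 1) g j (circ P h f i x y) z =
        signed (comp_mod P (h + f + g - 2)) ((int f - 1) * (int g - 1))
          (circ P (h + g - 1) f (i + g - 1) (circ P h g j x z) y)"
    and circ_nested: "\<And>h f g i j x y z.
      \<lbrakk>x \<in> carrier (comp_mod P h); y \<in> carrier (comp_mod P f); z \<in> carrier (comp_mod P g);
        i < h; j < h + f - 1; i \<le> j; j < i + f\<rbrakk> \<Longrightarrow>
      circ P (h + f - 1) g j (circ P h f i x y) z =
        circ P h (f + g - 1) i x (circ P f g (j - i) y z)"
    and circ_right: "\<And>h f g i j x y z.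
      \<lbrakk>x \<in> carrier (comp_mod P h); y \<in> carrier (comp_mod P f); z \<in> carrier (comp_mod P g);
        i < h; j < h + f - 1; i + f \<le> j\<rbrakk> \<Longrightarrow>
      circ P (h + f - 1) g j (circ P h f i x y) z =
        signed (comp_mod P (h + f + g - 2)) ((int f - 1) * (int g - 1))
          (circ P (h + g - 1) f i (circ P h g (j + 1 - f) x z) y)"
    and unit_closed: "unit_elem P \<in> carrier (comp_mod P 1)"
    and unit_left: "\<And>f y. y \<in> carrier (comp_mod P f) \<Longrightarrow> circ P 1 f 0 (unit_elem P) y = y"
    and unit_right: "\<And>f i y. y \<in> carrier (comp_mod P f) \<Longrightarrow> i < f \<Longrightarrow>
      circ P f 1 i y (unit_elem P) = y"

text \<open>
  The convention \<open>C\<^sup>n = 0\<close> for \<open>n < 0\<close>: negative degrees do occur, for instance \<open>h \<bullet> f \<in> C\<^sup>-\<^sup>1\<close>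
  for \<open>h, f \<in> C\<^sup>0\<close>.  The zero module is realised as the zero submodule of \<open>C\<^sup>0\<close>.
\<close>

definition grmod :: "('k, 'a) pre_operad_data \<Rightarrow> int \<Rightarrow> ('k, 'a) module" where
  "grmod P n =
    (if n < 0 then (comp_mod P 0)\<lparr>carrier := {\<zero>\<^bsub>comp_mod P 0\<^esub>}\<rparr> else comp_mod P (nat n))"

text \<open>
  Partial composition in integer degrees.  An argument of negative degree is zero, so the
  composition is then zero.  An index outside \<open>{0..m - 1}\<close> arises below only in \<open>cup\<close> with a
  left factor of negative degree, which again is zero.
\<close>

definition pcomp :: "('k, 'a) pre_operad_data \<Rightarrow> int \<Rightarrow> int \<Rightarrow> int \<Rightarrow> 'a \<Rightarrow> 'a \<Rightarrow> 'a" where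
  "pcomp P m n i x y =
    (if 0 \<le> i \<and> i \<le> m - 1 \<and> 0 \<le> n then circ P (nat m) (nat n) (nat i) x y
     else \<zero>\<^bsub>grmod P (m + n - 1)\<^esub>)"

text \<open>In the following, \<open>h\<close>, \<open>f\<close>, \<open>g\<close> are the degrees of \<open>x\<close>, \<open>y\<close>, \<open>z\<close> respectively.\<close>

definition cup :: "('k, 'a) pre_operad_data \<Rightarrow> 'a \<Rightarrow> int \<Rightarrow> int \<Rightarrow> 'a \<Rightarrow> 'a \<Rightarrow> 'a" where
  "cup P \<mu> f g y z = signed (grmod P (f + g)) f (pcomp P (f + 1) g f (pcomp P 2 f 0 \<mu> y) z)"

definition total_comp :: "('k, 'a) pre_operad_data \<Rightarrow> int \<Rightarrow> int \<Rightarrow> 'a \<Rightarrow> 'a \<Rightarrow> 'a" where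
  "total_comp P f g y z = (\<Oplus>\<^bsub>grmod P (f + g - 1)\<^esub>i \<in> {0..f - 1}. pcomp P f g i y z)"

definition pre_coboundary :: "('k, 'a) pre_operad_data \<Rightarrow> 'a \<Rightarrow> int \<Rightarrow> 'a \<Rightarrow> 'a" where
  "pre_coboundary P \<mu> f y =
    \<ominus>\<^bsub>grmod P (f + 1)\<^esub>
      (total_comp P f 2 y \<mu> \<ominus>\<^bsub>grmod P (f + 1)\<^esub>
        signed (grmod P (f + 1)) (f - 1) (total_comp P 2 f \<mu> y))"

definition tribrace ::
  "('k, 'a) pre_operad_data \<Rightarrow> int \<Rightarrow> int \<Rightarrow> int \<Rightarrow> 'a \<Rightarrow> 'a \<Rightarrow> 'a \<Rightarrow> 'a" where
  "tribrace P h f g x y z =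
    (\<Oplus>\<^bsub>grmod P (h + f + g - 2)\<^esub>i \<in> {0..(h - 1) - 1}.
      \<Oplus>\<^bsub>grmod P (h + f + g - 2)\<^esub>j \<in> {i + f..(f - 1) + (h - 1)}.
        pcomp P (h + f - 1) g j (pcomp P h f i x y) z)"

definition tribrace_dev ::
  "('k, 'a) pre_operad_data \<Rightarrow> 'a \<Rightarrow> int \<Rightarrow> int \<Rightarrow> int \<Rightarrow> 'a \<Rightarrow> 'a \<Rightarrow> 'a \<Rightarrow> 'a" where
  "tribrace_dev P \<mu> h f g x y z =
    (let L = grmod P (h + f + g - 1); \<delta> = pre_coboundary P \<mu> in
      \<delta> (h + f + g - 2) (tribrace P h f g x y z)
      \<ominus>\<^bsub>L\<^esub> tribrace P h f (g + 1) x y (\<delta> g z)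
      \<ominus>\<^bsub>L\<^esub> signed L (g - 1) (tribrace P h (f + 1) g x (\<delta> f y) z)
      \<ominus>\<^bsub>L\<^esub> signed L ((g - 1) + (f - 1)) (tribrace P (h + 1) f g (\<delta> h x) y z))"

end

theory Submission
  imports Defs "HOL-Algebra.AbelCoset"
begin

text \<open>
  Write \<open>x, y, z\<close> for the elements of degrees \<open>h, f, g\<close>.  The tribrace \<open>{x, y, z}\<close> is the sum, over
  pairs \<open>i < j\<close> of inputs of \<open>x\<close>, of the element obtained by inserting \<open>y\<close> at \<open>i\<close> and \<open>z\<close> at \<open>j\<close>.  Since
  \<open>-\<delta>u\<close> is \<open>u \<bullet> \<mu>\<close> minus \<open>\<plusminus> \<mu> \<bullet> u\<close>, the derivation deviation is a signed sum of eight such expressions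
  with one additional insertion of, or into, \<open>\<mu>\<close>.  All of them are sums over places where \<open>\<mu>\<close> can
  be put, and the theorem amounts to matching these places.

  In \<open>{x, y, z} \<bullet> \<mu>\<close> the element \<open>\<mu>\<close> is inserted into \<open>y\<close>, into \<open>z\<close>, or into an input \<open>l\<close> of \<open>x\<close> other
  than \<open>i\<close> and \<open>j\<close> (\<open>total_comp_tri_mu\<close>).  The first two kinds give \<open>{x, y \<bullet> \<mu>, z}\<close> and
  \<open>{x, y, z \<bullet> \<mu>}\<close>.  The third kind is also the part of \<open>{x \<bullet> \<mu>, y, z}\<close> where \<open>y\<close> and \<open>z\<close> avoid the two
  inputs of \<open>\<mu>\<close>.  In the rest of \<open>{x \<bullet> \<mu>, y, z}\<close> one input of \<open>\<mu>\<close> is taken by \<open>y\<close>, one is taken by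
  \<open>z\<close>, or both are taken, which yields \<open>{x, \<mu> \<bullet> y, z}\<close>, \<open>{x, y, \<mu> \<bullet> z}\<close> and \<open>x \<bullet> (y \<smile> z)\<close>
  (\<open>tribrace_x_mu\<close>).  Finally, in \<open>{\<mu> \<bullet> x, y, z}\<close> either \<open>y\<close> and \<open>z\<close> are both inserted into \<open>x\<close>,
  which gives \<open>\<mu> \<bullet> {x, y, z}\<close>, or one of them takes the free input of \<open>\<mu>\<close>, which gives
  \<open>(x \<bullet> y) \<smile> z\<close> and \<open>y \<smile> (x \<bullet> z)\<close> (\<open>tribrace_mu_x\<close>).  Everything cancels except the three cup terms
  (\<open>deviation_signs\<close>).
\<close>

section \<open>Finite sums in abelian monoids\<close>

lemma (in abelian_monoid) finsum_bij:
  assumes "bij_betw b A B" "u \<in> B \<rightarrow> carrier G" "\<And>a. a \<in> A \<Longrightarrow> v a = u (b a)"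
  shows "finsum G v A = finsum G u B"
proof -
  have im: "B = b ` A" "inj_on b A" using assms(1) by (auto simp: bij_betw_def)
  have "finsum G v A = finsum G (\<lambda>a. u (b a)) A"
    by (rule finsum_cong') (use assms im in auto)
  also have "\<dots> = finsum G u B"
    unfolding im(1) by (rule finsum_reindex[symmetric]) (use assms im in auto)
  finally show ?thesis .
qed

lemma (in abelian_monoid) finsum_Sigma:
  assumes "finite A" "\<And>a. a \<in> A \<Longrightarrow> finite (B a)"
    and "\<And>a b. a \<in> A \<Longrightarrow> b \<in> B a \<Longrightarrow> u a b \<in> carrier G"
  shows "(\<Oplus>a\<in>A. \<Oplus>b\<in>B a. u a b) = (\<Oplus>p\<in>Sigma A B. u (fst p) (snd p))"
  using assms
proof (induction A rule: finite_induct)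
  case empty
  then show ?case by simp
next
  case (insert a A)
  have "(\<Oplus>p\<in>Sigma (insert a A) B. u (fst p) (snd p)) =
      (\<Oplus>p\<in>Pair a ` B a \<union> Sigma A B. u (fst p) (snd p))"
    by (rule arg_cong[where f = "finsum G _"]) auto
  also have "\<dots> = (\<Oplus>p\<in>Pair a ` B a. u (fst p) (snd p)) \<oplus> (\<Oplus>p\<in>Sigma A B. u (fst p) (snd p))"
    by (rule finsum_Un_disjoint) (use insert in auto)
  also have "(\<Oplus>p\<in>Pair a ` B a. u (fst p) (snd p)) = (\<Oplus>b\<in>B a. u a b)"
    by (rule finsum_bij[symmetric, where b = "Pair a"])
       (use insert in \<open>auto simp: bij_betw_def inj_on_def\<close>)
  finally show ?case using insert by (simp add: Pi_def)
qed

lemma (in abelian_monoid) finsum_subset_diff: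
  assumes "finite S" "S1 \<subseteq> S" "S2 = S - S1" "u \<in> S \<rightarrow> carrier G"
  shows "finsum G u S = finsum G u S1 \<oplus> finsum G u S2"
proof -
  have "S = S1 \<union> S2" using assms by auto
  then have "finsum G u S = finsum G u (S1 \<union> S2)" by (rule arg_cong)
  also have "\<dots> = finsum G u S1 \<oplus> finsum G u S2"
    by (rule finsum_Un_disjoint) (use assms in \<open>auto intro: finite_subset\<close>)
  finally show ?thesis .
qed

section \<open>Sums over pairs of inputs\<close>

definition pairs :: "int \<Rightarrow> (int \<times> int) set" where
  "pairs m = {(i, j). 0 \<le> i \<and> i < j \<and> j < m}"

lemma finite_pairs [simp]: "finite (pairs m)"
  by (rule finite_subset[of _ "{0..<m} \<times> {0..<m}"]) (auto simp: pairs_def)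

text \<open>
  Replacing the input \<open>l\<close> of an operation by an operation with two inputs turns the input
  \<open>i \<noteq> l\<close> into the input \<open>skip l i\<close>.
\<close>

definition skip :: "int \<Rightarrow> int \<Rightarrow> int" where
  "skip l i = (if l < i then i + 1 else i)"

lemma (in abelian_monoid) finsum_pairs_last:
  assumes w: "\<And>i j. w i j \<in> carrier G"
  shows "(\<Oplus>p\<in>pairs (m + 1). w (fst p) (snd p)) =
    (\<Oplus>p\<in>pairs m. w (fst p) (snd p)) \<oplus> (\<Oplus>i\<in>{0..m - 1}. w i m)"
proof -
  let ?u = "\<lambda>p. w (fst p) (snd p)"
  have "pairs (m + 1) = pairs m \<union> (\<lambda>i. (i, m)) ` {0..m - 1}"
    by (auto simp: pairs_def)
  also have "finsum G ?u \<dots> = finsum G ?u (pairs m) \<oplus> finsum G ?u ((\<lambda>i. (i, m)) ` {0..m - 1})"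
    by (rule finsum_Un_disjoint) (simp_all add: w, auto simp: pairs_def)
  also have "finsum G ?u ((\<lambda>i. (i, m)) ` {0..m - 1}) = (\<Oplus>i\<in>{0..m - 1}. w i m)"
    by (subst finsum_reindex) (auto simp: w inj_on_def)
  finally show ?thesis .
qed

lemma (in abelian_monoid) finsum_pairs_first:
  assumes w: "\<And>i j. w i j \<in> carrier G"
  shows "(\<Oplus>p\<in>pairs (m + 1). w (fst p) (snd p)) =
    (\<Oplus>p\<in>pairs m. w (fst p + 1) (snd p + 1)) \<oplus> (\<Oplus>j\<in>{0..m - 1}. w 0 (j + 1))"
proof -
  let ?u = "\<lambda>p. w (fst p) (snd p)"
  let ?S = "{(i, j) \<in> pairs (m + 1). 0 < i}" and ?Z = "{(i, j) \<in> pairs (m + 1). i = 0}"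
  have "finsum G ?u (pairs (m + 1)) = finsum G ?u ?S \<oplus> finsum G ?u ?Z"
    by (rule finsum_subset_diff, simp, blast) (auto simp: pairs_def w)
  also have "finsum G ?u ?S = (\<Oplus>p\<in>pairs m. w (fst p + 1) (snd p + 1))"
    by (rule finsum_bij[symmetric, where b = "\<lambda>(i, j). (i + 1, j + 1)"])
      (auto simp: pairs_def w intro!: bij_betw_byWitness[where f' = "\<lambda>(i, j). (i - 1, j - 1)"])
  also have "finsum G ?u ?Z = (\<Oplus>j\<in>{0..m - 1}. w 0 (j + 1))"
    by (rule finsum_bij[symmetric, where b = "\<lambda>j. (0, j + 1)"])
      (auto simp: pairs_def w intro!: bij_betw_byWitness[where f' = "\<lambda>(i, j). j - 1"])
  finally show ?thesis .
qed

text \<open>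
  Here \<open>w l i j\<close> stands for a term in which the inputs \<open>i < j\<close> of \<open>x \<circ>\<^sub>l \<mu>\<close> are filled, \<open>x\<close> having \<open>m\<close>
  inputs.  The pairs are sorted by how they meet the two inputs \<open>l, l + 1\<close> of \<open>\<mu>\<close>:
  both avoid them, both are inputs of \<open>\<mu>\<close>, only \<open>i\<close> is one, or only \<open>j\<close> is one.
\<close>

lemma (in abelian_monoid) finsum_pairs_double:
  assumes w: "\<And>l i j. w l i j \<in> carrier G"
  shows "(\<Oplus>l\<in>{0..m - 1}. \<Oplus>p\<in>pairs (m + 1). w l (fst p) (snd p)) =
    (\<Oplus>p\<in>pairs m. \<Oplus>l\<in>{0..m - 1} - {fst p, snd p}. w l (skip l (fst p)) (skip l (snd p))) \<oplus>
    ((\<Oplus>l\<in>{0..m - 1}. w l l (l + 1)) \<oplus>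
    ((\<Oplus>p\<in>pairs m. w (fst p) (fst p) (snd p + 1) \<oplus> w (fst p) (fst p + 1) (snd p + 1)) \<oplus>
    (\<Oplus>p\<in>pairs m. w (snd p) (fst p) (snd p) \<oplus> w (snd p) (fst p) (snd p + 1))))"
proof -
  let ?u = "\<lambda>q. w (fst q) (fst (snd q)) (snd (snd q))"
  let ?T = "{0..m - 1} \<times> pairs (m + 1)"
  let ?A = "{(l, i, j) \<in> ?T. i \<noteq> l \<and> i \<noteq> l + 1 \<and> j \<noteq> l \<and> j \<noteq> l + 1}"
  let ?A' = "{(l, i, j) \<in> ?T. i = l \<or> i = l + 1 \<or> j = l \<or> j = l + 1}"
  let ?B = "{(l, i, j) \<in> ?T. i = l \<and> j = l + 1}"
  let ?B' = "{(l, i, j) \<in> ?T. i = l \<and> j > l + 1 \<or> i = l + 1 \<or> j = l \<or> i < l \<and> j = l + 1}"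
  let ?C = "{(l, i, j) \<in> ?T. i = l \<and> j > l + 1 \<or> i = l + 1}"
  let ?C1 = "{(l, i, j) \<in> ?T. i = l \<and> j > l + 1}"
  let ?C2 = "{(l, i, j) \<in> ?T. i = l + 1}"
  let ?D = "{(l, i, j) \<in> ?T. j = l \<or> i < l \<and> j = l + 1}"
  let ?D1 = "{(l, i, j) \<in> ?T. j = l}"
  let ?D2 = "{(l, i, j) \<in> ?T. i < l \<and> j = l + 1}"
  have fin: "finite {(l, i, j). (l, i, j) \<in> ?T \<and> Q l i j}" for Q
    by (rule finite_subset[of _ ?T]) auto
  have "(\<Oplus>l\<in>{0..m - 1}. \<Oplus>p\<in>pairs (m + 1). w l (fst p) (snd p)) = finsum G ?u ?T"
    by (subst finsum_Sigma) (auto simp: w)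
  also have "\<dots> = finsum G ?u ?A \<oplus> finsum G ?u ?A'"
    by (rule finsum_subset_diff, simp, blast) (auto simp: w)
  also have "finsum G ?u ?A' = finsum G ?u ?B \<oplus> finsum G ?u ?B'"
    by (rule finsum_subset_diff, rule fin, blast) (auto simp: pairs_def w)
  also have "finsum G ?u ?B' = finsum G ?u ?C \<oplus> finsum G ?u ?D"
    by (rule finsum_subset_diff, rule fin, blast) (auto simp: pairs_def w)
  also have "finsum G ?u ?C = finsum G ?u ?C1 \<oplus> finsum G ?u ?C2"
    by (rule finsum_subset_diff, rule fin, blast) (auto simp: pairs_def w)
  also have "finsum G ?u ?D = finsum G ?u ?D1 \<oplus> finsum G ?u ?D2"
    by (rule finsum_subset_diff, rule fin, blast) (auto simp: pairs_def w)
  also have "finsum G ?u ?A =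
      (\<Oplus>p\<in>pairs m. \<Oplus>l\<in>{0..m - 1} - {fst p, snd p}. w l (skip l (fst p)) (skip l (snd p)))"
    apply (subst finsum_Sigma, simp, simp, simp add: w)
    apply (rule finsum_bij[symmetric, where b = "\<lambda>((i, j), l). (l, skip l i, skip l j)"])
    apply (rule bij_betw_byWitness[where f' = "\<lambda>(l, i, j). ((if l < i then i - 1 else i, if l < j then j - 1 else j), l)"])
    apply (auto simp: pairs_def skip_def w split: if_splits)
    done
  also have "finsum G ?u ?B = (\<Oplus>l\<in>{0..m - 1}. w l l (l + 1))"
    by (rule finsum_bij[symmetric, where b = "\<lambda>l. (l, l, l + 1)"])
      (auto simp: pairs_def w intro!: bij_betw_byWitness[where f' = fst])
  also have "finsum G ?u ?C1 = (\<Oplus>p\<in>pairs m. w (fst p) (fst p) (snd p + 1))"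
    by (rule finsum_bij[symmetric, where b = "\<lambda>(i, j). (i, i, j + 1)"])
      (auto simp: pairs_def w intro!: bij_betw_byWitness[where f' = "\<lambda>(l, i, j). (i, j - 1)"])
  also have "finsum G ?u ?C2 = (\<Oplus>p\<in>pairs m. w (fst p) (fst p + 1) (snd p + 1))"
    by (rule finsum_bij[symmetric, where b = "\<lambda>(i, j). (i, i + 1, j + 1)"])
      (auto simp: pairs_def w intro!: bij_betw_byWitness[where f' = "\<lambda>(l, i, j). (l, j - 1)"])
  also have "finsum G ?u ?D1 = (\<Oplus>p\<in>pairs m. w (snd p) (fst p) (snd p))"
    by (rule finsum_bij[symmetric, where b = "\<lambda>(i, j). (j, i, j)"])
      (auto simp: pairs_def w intro!: bij_betw_byWitness[where f' = snd])
  also have "finsum G ?u ?D2 = (\<Oplus>p\<in>pairs m. w (snd p) (fst p) (snd p + 1))"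
    by (rule finsum_bij[symmetric, where b = "\<lambda>(i, j). (j, i, j + 1)"])
      (auto simp: pairs_def w intro!: bij_betw_byWitness[where f' = "\<lambda>(l, i, j). (i, l)"])
  finally show ?thesis by (simp add: finsum_addf w)
qed

section \<open>Additive maps and signs\<close>

lemma (in abelian_group_hom) hom_finsum:
  assumes "u \<in> A \<rightarrow> carrier G"
  shows "h (finsum G u A) = finsum H (\<lambda>a. h (u a)) A"
proof (cases "finite A")
  case True
  then show ?thesis using assms
    by (induction A rule: finite_induct) (auto simp: Pi_def)
next
  case False
  then show ?thesis by (simp add: G.finsum_infinite H.finsum_infinite)
qed

text \<open>
  Compositions and tribraces are additive in each argument, so this lets signs pass out of them.
\<close>

lemma hom_signed:
  "abelian_group_hom G H \<phi> \<Longrightarrow> a \<in> carrier G \<Longrightarrow> \<phi> (signed G n a) = signed H n (\<phi> a)"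
  by (simp add: signed_def abelian_group_hom.hom_a_inv)

lemma abelian_group_hom_additiveI:
  assumes "abelian_group G" "abelian_group H" "\<And>a. a \<in> carrier G \<Longrightarrow> \<phi> a \<in> carrier H"
    "\<And>a b. a \<in> carrier G \<Longrightarrow> b \<in> carrier G \<Longrightarrow> \<phi> (a \<oplus>\<^bsub>G\<^esub> b) = \<phi> a \<oplus>\<^bsub>H\<^esub> \<phi> b"
  shows "abelian_group_hom G H \<phi>"
  using assms by (intro abelian_group_homI group_hom.intro group_hom_axioms.intro)
     (auto simp: hom_def abelian_group.a_group)

lemma abelian_group_hom_finsum:
  assumes "abelian_group G" "abelian_group H" "\<And>i. i \<in> A \<Longrightarrow> abelian_group_hom G H (\<phi> i)"
  shows "abelian_group_hom G H (\<lambda>a. \<Oplus>\<^bsub>H\<^esub>i\<in>A. \<phi> i a)"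
proof -
  interpret G: abelian_group G by fact
  interpret H: abelian_group H by fact
  show ?thesis
  proof (rule abelian_group_hom_additiveI)
    fix a b assume ab: "a \<in> carrier G" "b \<in> carrier G"
    have cl: "\<phi> i a \<in> carrier H" "\<phi> i b \<in> carrier H" "\<phi> i (a \<oplus>\<^bsub>G\<^esub> b) = \<phi> i a \<oplus>\<^bsub>H\<^esub> \<phi> i b"
      if "i \<in> A" for i
      using assms(3)[OF that] ab by (auto simp: abelian_group_hom.hom_closed abelian_group_hom.hom_add)
    have "(\<Oplus>\<^bsub>H\<^esub>i\<in>A. \<phi> i (a \<oplus>\<^bsub>G\<^esub> b)) = (\<Oplus>\<^bsub>H\<^esub>i\<in>A. \<phi> i a \<oplus>\<^bsub>H\<^esub> \<phi> i b)"
      by (rule H.finsum_cong') (auto simp: cl)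
    also have "\<dots> = (\<Oplus>\<^bsub>H\<^esub>i\<in>A. \<phi> i a) \<oplus>\<^bsub>H\<^esub> (\<Oplus>\<^bsub>H\<^esub>i\<in>A. \<phi> i b)"
      by (rule H.finsum_addf) (auto simp: cl)
    finally show "(\<Oplus>\<^bsub>H\<^esub>i\<in>A. \<phi> i (a \<oplus>\<^bsub>G\<^esub> b)) = (\<Oplus>\<^bsub>H\<^esub>i\<in>A. \<phi> i a) \<oplus>\<^bsub>H\<^esub> (\<Oplus>\<^bsub>H\<^esub>i\<in>A. \<phi> i b)" .
  qed (use assms in \<open>auto intro!: H.finsum_closed abelian_group_hom.hom_closed[where G = G]\<close>)
qed

lemma abelian_group_hom_compose:
  assumes "abelian_group_hom G H \<phi>" "abelian_group_hom H L \<psi>"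
  shows "abelian_group_hom G L (\<lambda>a. \<psi> (\<phi> a))"
  using abelian_group_hom.axioms(1)[OF assms(1)] abelian_group_hom.axioms(2)[OF assms(2)]
  by (intro abelian_group_hom_additiveI)
    (auto simp: abelian_group_hom.hom_closed[OF assms(1)] abelian_group_hom.hom_add[OF assms(1)]
      abelian_group_hom.hom_closed[OF assms(2)] abelian_group_hom.hom_add[OF assms(2)])

lemma signed_hom: "abelian_group G \<Longrightarrow> abelian_group_hom G G (signed G n)"
  by (rule abelian_group_hom_additiveI) (auto simp: signed_def abelian_group.minus_add abelian_group.a_inv_closed)

lemma signed_closed: "abelian_group G \<Longrightarrow> a \<in> carrier G \<Longrightarrow> signed G n a \<in> carrier G"
  by (simp add: signed_def abelian_group.a_inv_closed)

lemma signed_signed: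
  "abelian_group G \<Longrightarrow> a \<in> carrier G \<Longrightarrow> signed G m (signed G n a) = signed G (m + n) a"
  by (simp add: signed_def abelian_group.minus_minus)

lemma signed_cong: "even (m - n) \<Longrightarrow> signed G m a = signed G n a"
  by (auto simp: signed_def)

text \<open>
  The sign bookkeeping of the theorem, with nine independent elements \<open>a0, ..., i0\<close>.  Here \<open>T1, T7, T8\<close>
  are to be \<open>{x, y, z} \<bullet> \<mu>\<close>, \<open>{x \<bullet> \<mu>, y, z}\<close> and \<open>{\<mu> \<bullet> x, y, z}\<close>; the element \<open>a0\<close> collects the terms in which \<open>\<mu>\<close> touches neither \<open>y\<close> nor \<open>z\<close>;
  \<open>b0, c0\<close> are the tribraces with \<open>y \<bullet> \<mu>\<close> and \<open>z \<bullet> \<mu>\<close>; \<open>e0, f0\<close> those with \<open>\<mu> \<bullet> y\<close> and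
  \<open>\<mu> \<bullet> z\<close>; \<open>g0\<close> is \<open>\<mu> \<bullet> {x, y, z}\<close>; and \<open>h0, i0, d0\<close> are \<open>(x \<bullet> y) \<smile> z\<close>,
  \<open>y \<smile> (x \<bullet> z)\<close> and \<open>x \<bullet> (y \<smile> z)\<close>, the terms that survive.
\<close>

lemma deviation_signs:
  fixes G :: "('k, 'a, 'm) module_scheme" (structure) and f g h :: int
  assumes G: "abelian_group G"
    and carr: "a0 \<in> carrier G" "b0 \<in> carrier G" "c0 \<in> carrier G" "d0 \<in> carrier G" "e0 \<in> carrier G"
    "f0 \<in> carrier G" "g0 \<in> carrier G" "h0 \<in> carrier G" "i0 \<in> carrier G"
    and T1: "T1 = signed G (f + g) a0 \<oplus> (signed G (g - 1) b0 \<oplus> c0)"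
    and T7: "T7 = a0 \<oplus> (signed G f d0 \<oplus> (e0 \<oplus> signed G (f - 1) f0))"
    and T8: "T8 = g0 \<oplus> (signed G (h + f - 1) h0 \<oplus> signed G ((h - 1) * (f - 1) + f) i0)"
  shows "signed G (g - 1) (\<ominus> (T1 \<ominus> signed G (h + f + g - 2 - 1) g0) \<ominus> \<ominus> (c0 \<ominus> signed G (g - 1) f0) \<ominus>
     signed G (g - 1) (\<ominus> (b0 \<ominus> signed G (f - 1) e0)) \<ominus> signed G ((g - 1) + (f - 1)) (\<ominus> (T7 \<ominus> signed G (h - 1) T8)))
     = h0 \<oplus> signed G ((h - 1) * f) i0 \<ominus> d0"
proof -
  interpret abelian_group G by (rule G)
  \<comment> \<open>Naming the inverses makes the term order used by associative-commutative rewriting put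
    \<open>u0\<close> next to \<open>u1 = \<ominus> u0\<close>, so that rewriting with \<open>z\<close> and \<open>z''\<close> cancels them.\<close>
  obtain a1 b1 c1 d1 e1 f1 g1 h1 i1 where
    inv: "\<ominus> a0 = a1" "\<ominus> b0 = b1" "\<ominus> c0 = c1" "\<ominus> d0 = d1" "\<ominus> e0 = e1" "\<ominus> f0 = f1"
     "\<ominus> g0 = g1" "\<ominus> h0 = h1" "\<ominus> i0 = i1" by blast
  have carr': "a1 \<in> carrier G" "b1 \<in> carrier G" "c1 \<in> carrier G" "d1 \<in> carrier G" "e1 \<in> carrier G"
    "f1 \<in> carrier G" "g1 \<in> carrier G" "h1 \<in> carrier G" "i1 \<in> carrier G"
    using carr inv by auto
  have inv': "\<ominus> a1 = a0" "\<ominus> b1 = b0" "\<ominus> c1 = c0" "\<ominus> d1 = d0" "\<ominus> e1 = e0" "\<ominus> f1 = f0"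
     "\<ominus> g1 = g0" "\<ominus> h1 = h0" "\<ominus> i1 = i0"
    using carr inv minus_minus by blast+
  have z: "a0 \<oplus> a1 = \<zero>" "b0 \<oplus> b1 = \<zero>" "c0 \<oplus> c1 = \<zero>" "d0 \<oplus> d1 = \<zero>" "e0 \<oplus> e1 = \<zero>"
     "f0 \<oplus> f1 = \<zero>" "g0 \<oplus> g1 = \<zero>" "h0 \<oplus> h1 = \<zero>" "i0 \<oplus> i1 = \<zero>"
    using carr inv r_neg by blast+
  have z': "u \<oplus> (v \<oplus> w) = w" if "u \<oplus> v = \<zero>" "u \<in> carrier G" "v \<in> carrier G" "w \<in> carrier G" for u v w
    using that by (simp flip: a_assoc)
  note z'' = z[THEN z']
  show ?thesis
    unfolding T1 T7 T8 signed_def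
    by (cases "even h"; cases "even f"; cases "even g";
      simp add: a_minus_def minus_add carr carr' inv inv' a_ac z z'')
qed

section \<open>Pre-operads in integer degrees\<close>

context pre_operad
begin

lemma grmod_group: "abelian_group (grmod P n)"
proof (cases "n < 0")
  case True
  interpret M: abelian_group "comp_mod P 0" using modules module.axioms(2) by blast
  show ?thesis using True unfolding grmod_def by (auto intro!: abelian_groupI)
next
  case False
  then show ?thesis using modules[of "nat n"] by (simp add: grmod_def module.axioms(2))
qed

lemma grmod_nat: "0 \<le> n \<Longrightarrow> grmod P n = comp_mod P (nat n)"
  by (simp add: grmod_def)

lemma pcomp_hom_left:
  assumes y: "y \<in> carrier (grmod P n)" and p: "p = m + n - 1"
  shows "abelian_group_hom (grmod P m) (grmod P p) (\<lambda>x. pcomp P m n i x y)"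
proof (cases "0 \<le> i \<and> i \<le> m - 1 \<and> 0 \<le> n")
  case True
  then have *: "nat i < nat m" "nat p = nat m + nat n - Suc 0" "0 \<le> m" "0 \<le> n" "0 \<le> p" using p by auto
  show ?thesis
    using circ_bilinear[OF *(1), of "nat n"] True y
    by (intro abelian_group_hom_additiveI grmod_group)
      (auto simp: bilinear_map_def pcomp_def grmod_nat *)
next
  case False
  interpret L: abelian_group "grmod P p" by (rule grmod_group)
  from False show ?thesis
    by (intro abelian_group_hom_additiveI grmod_group) (auto simp: pcomp_def simp flip: p)
qed

lemma pcomp_hom_right:
  assumes x: "x \<in> carrier (grmod P m)" and p: "p = m + n - 1"
  shows "abelian_group_hom (grmod P n) (grmod P p) (pcomp P m n i x)"
proof (cases "0 \<le> i \<and> i \<le> m - 1 \<and> 0 \<le> n")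
  case True
  then have *: "nat i < nat m" "nat p = nat m + nat n - Suc 0" "0 \<le> m" "0 \<le> n" "0 \<le> p" using p by auto
  show ?thesis
    using circ_bilinear[OF *(1), of "nat n"] True x
    by (intro abelian_group_hom_additiveI grmod_group)
      (auto simp: bilinear_map_def pcomp_def grmod_nat *)
next
  case False
  interpret L: abelian_group "grmod P p" by (rule grmod_group)
  from False show ?thesis
    by (intro abelian_group_hom_additiveI grmod_group) (auto simp: pcomp_def simp flip: p)
qed

lemma pcomp_closed:
  "x \<in> carrier (grmod P m) \<Longrightarrow> y \<in> carrier (grmod P n) \<Longrightarrow> p = m + n - 1 \<Longrightarrow>
    pcomp P m n i x y \<in> carrier (grmod P p)"
  using abelian_group_hom.hom_closed[OF pcomp_hom_right] by blast

lemma pcomp_circ: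
  "m = int m' \<Longrightarrow> n = int n' \<Longrightarrow> i = int i' \<Longrightarrow> i' < m' \<Longrightarrow> pcomp P m n i x y = circ P m' n' i' x y"
  by (simp add: pcomp_def)

text \<open>
  The three cases of the composition axiom in integer degrees.  The degrees and indices that
  occur in the axiom are variables restricted by equations, since the same integer is written
  in different ways where these lemmas are applied.
\<close>

lemma pcomp_left:
  assumes carr: "x \<in> carrier (grmod P h)" "y \<in> carrier (grmod P f)" "z \<in> carrier (grmod P g)"
    and "0 \<le> f" "0 \<le> g" "0 \<le> j" "j < i" "i < h"
    and deg: "a = h + f - 1" "b = h + g - 1" "n = h + f + g - 2" "k = i + g - 1"
  shows "pcomp P a g j (pcomp P h f i x y) z =
    signed (grmod P n) ((f - 1) * (g - 1)) (pcomp P b f k (pcomp P h g j x z) y)"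
proof -
  obtain h' f' g' i' j' where
    int: "h = int h'" "f = int f'" "g = int g'" "i = int i'" "j = int j'"
    using assms(4-8) by (metis nonneg_int_cases order.strict_implies_order order.strict_trans1)
  have lt: "j' < i'" "i' < h'" using assms int by auto
  have "pcomp P h f i x y = circ P h' f' i' x y" "pcomp P h g j x z = circ P h' g' j' x z"
    using lt by (auto intro!: pcomp_circ int)
  moreover have "pcomp P a g j u z = circ P (h' + f' - 1) g' j' u z" for u
    using lt deg by (intro pcomp_circ) (auto simp: int)
  moreover have "pcomp P b f k u y = circ P (h' + g' - 1) f' (i' + g' - 1) u y" for u
    using lt deg by (intro pcomp_circ) (auto simp: int)
  moreover have "grmod P n = comp_mod P (h' + f' + g' - 2)"
    using lt unfolding deg int by (subst grmod_nat) (auto intro!: arg_cong[where f = "comp_mod P"])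
  moreover have "x \<in> carrier (comp_mod P h')" "y \<in> carrier (comp_mod P f')" "z \<in> carrier (comp_mod P g')"
    using carr by (auto simp: grmod_nat int)
  ultimately show ?thesis
    using circ_left[of x h' y f' z g' i' j'] lt int by simp
qed

lemma pcomp_nested:
  assumes carr: "x \<in> carrier (grmod P h)" "y \<in> carrier (grmod P f)" "z \<in> carrier (grmod P g)"
    and "0 \<le> f" "0 \<le> g" "0 \<le> i" "i < h" "i \<le> j" "j < i + f"
    and deg: "a = h + f - 1" "b = f + g - 1" "k = j - i"
  shows "pcomp P a g j (pcomp P h f i x y) z = pcomp P h b i x (pcomp P f g k y z)"
proof -
  obtain h' f' g' i' j' where
    int: "h = int h'" "f = int f'" "g = int g'" "i = int i'" "j = int j'"
    using assms(4-9) by (metis nonneg_int_cases order.strict_implies_order order.trans)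
  have lt: "i' < h'" "i' \<le> j'" "j' < i' + f'" using assms int by auto
  have "pcomp P h f i x y = circ P h' f' i' x y"
    using lt by (auto intro!: pcomp_circ int)
  moreover have "pcomp P f g k y z = circ P f' g' (j' - i') y z"
    using lt deg by (intro pcomp_circ) (auto simp: int)
  moreover have "pcomp P a g j u z = circ P (h' + f' - 1) g' j' u z" for u
    using lt deg by (intro pcomp_circ) (auto simp: int)
  moreover have "pcomp P h b i x u = circ P h' (f' + g' - 1) i' x u" for u
    using lt deg by (intro pcomp_circ) (auto simp: int)
  moreover have "x \<in> carrier (comp_mod P h')" "y \<in> carrier (comp_mod P f')" "z \<in> carrier (comp_mod P g')"
    using carr by (auto simp: grmod_nat int)
  ultimately show ?thesis
    using circ_nested[of x h' y f' z g' i' j'] lt int by simp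
qed

lemma pcomp_right:
  assumes carr: "x \<in> carrier (grmod P h)" "y \<in> carrier (grmod P f)" "z \<in> carrier (grmod P g)"
    and "0 \<le> f" "0 \<le> g" "0 \<le> i" "i < h" "i + f \<le> j" "j < h + f - 1"
    and deg: "a = h + f - 1" "b = h + g - 1" "n = h + f + g - 2" "k = j - f + 1"
  shows "pcomp P a g j (pcomp P h f i x y) z =
    signed (grmod P n) ((f - 1) * (g - 1)) (pcomp P b f i (pcomp P h g k x z) y)"
proof -
  have "0 \<le> h" "0 \<le> j" using assms by auto
  then obtain h' f' g' i' j' where
    int: "h = int h'" "f = int f'" "g = int g'" "i = int i'" "j = int j'"
    using assms(4-6) by (metis nonneg_int_cases)
  have lt: "i' < h'" "i' + f' \<le> j'" "j' < h' + f' - 1" using assms int by auto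
  have "pcomp P h f i x y = circ P h' f' i' x y"
    using lt by (auto intro!: pcomp_circ int)
  moreover have "pcomp P h g k x z = circ P h' g' (j' + 1 - f') x z"
    using lt deg by (intro pcomp_circ) (auto simp: int)
  moreover have "pcomp P a g j u z = circ P (h' + f' - 1) g' j' u z" for u
    using lt deg by (intro pcomp_circ) (auto simp: int)
  moreover have "pcomp P b f i u y = circ P (h' + g' - 1) f' i' u y" for u
    using lt deg by (intro pcomp_circ) (auto simp: int)
  moreover have "grmod P n = comp_mod P (h' + f' + g' - 2)"
    using lt unfolding deg int by (subst grmod_nat) (auto intro!: arg_cong[where f = "comp_mod P"])
  moreover have "x \<in> carrier (comp_mod P h')" "y \<in> carrier (comp_mod P f')" "z \<in> carrier (comp_mod P g')"
    using carr by (auto simp: grmod_nat int)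
  ultimately show ?thesis
    using circ_right[of x h' y f' z g' i' j'] lt int by simp
qed

lemma total_comp_hom_left:
  assumes "y \<in> carrier (grmod P n)" "p = m + n - 1"
  shows "abelian_group_hom (grmod P m) (grmod P p) (\<lambda>x. total_comp P m n x y)"
  unfolding total_comp_def assms(2)[symmetric]
  by (intro abelian_group_hom_finsum grmod_group pcomp_hom_left assms)

lemma total_comp_hom_right:
  assumes "x \<in> carrier (grmod P m)" "p = m + n - 1"
  shows "abelian_group_hom (grmod P n) (grmod P p) (total_comp P m n x)"
  unfolding total_comp_def assms(2)[symmetric]
  by (intro abelian_group_hom_finsum grmod_group pcomp_hom_right assms)

lemma total_comp_closed:
  "x \<in> carrier (grmod P m) \<Longrightarrow> y \<in> carrier (grmod P n) \<Longrightarrow> p = m + n - 1 \<Longrightarrow>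
    total_comp P m n x y \<in> carrier (grmod P p)"
  using abelian_group_hom.hom_closed[OF total_comp_hom_right] by blast

lemma hom_total_comp:
  assumes "abelian_group_hom (grmod P p) H \<phi>" "p = m + n - 1"
    and "x \<in> carrier (grmod P m)" "y \<in> carrier (grmod P n)"
  shows "\<phi> (total_comp P m n x y) = (\<Oplus>\<^bsub>H\<^esub>i\<in>{0..m - 1}. \<phi> (pcomp P m n i x y))"
  unfolding total_comp_def assms(2)[symmetric]
  by (rule abelian_group_hom.hom_finsum[OF assms(1)]) (auto intro!: pcomp_closed assms)

text \<open>
  \<open>(x \<circ>\<^sub>i y) \<circ>\<^bsub>j + |f|\<^esub> z\<close>, indexed by the inputs \<open>i < j\<close> of \<open>x\<close> that receive \<open>y\<close> and \<open>z\<close>.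
  With this indexing the range of summation of the tribraces depends on \<open>h\<close> only, and not on
  the degree of \<open>y\<close>, so that the tribraces in the derivation deviation become comparable.
\<close>

definition insert_two where
  "insert_two h f g x y z i j = pcomp P (h + f - 1) g (j + f - 1) (pcomp P h f i x y) z"

lemma insert_two_closed:
  "x \<in> carrier (grmod P h) \<Longrightarrow> y \<in> carrier (grmod P f) \<Longrightarrow> z \<in> carrier (grmod P g) \<Longrightarrow>
    p = h + f + g - 2 \<Longrightarrow> insert_two h f g x y z i j \<in> carrier (grmod P p)"
  by (simp add: insert_two_def pcomp_closed)

lemma tribrace_pairs:
  assumes "x \<in> carrier (grmod P h)" "y \<in> carrier (grmod P f)" "z \<in> carrier (grmod P g)"
    and p: "p = h + f + g - 2"
  shows "tribrace P h f g x y z =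
    (\<Oplus>\<^bsub>grmod P p\<^esub>q\<in>pairs h. insert_two h f g x y z (fst q) (snd q))"
proof -
  interpret L: abelian_group "grmod P p" by (rule grmod_group)
  show ?thesis
    unfolding tribrace_def p[symmetric]
    apply (subst L.finsum_Sigma)
       apply simp
      apply simp
    using assms apply (intro pcomp_closed) apply auto[5]
    apply (rule L.finsum_bij[where b = "\<lambda>(i, j). (i, j - f + 1)"])
    apply (rule bij_betw_byWitness[where f' = "\<lambda>(i, j). (i, j + f - 1)"])
    apply (auto simp: pairs_def insert_two_def p intro!: pcomp_closed assms(1-3))
    done
qed

lemma insert_two_hom2:
  assumes "x \<in> carrier (grmod P h)" "z \<in> carrier (grmod P g)" "p = h + f + g - 2"
  shows "abelian_group_hom (grmod P f) (grmod P p) (\<lambda>y. insert_two h f g x y z i j)"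
  unfolding insert_two_def
  by (intro abelian_group_hom_compose[OF pcomp_hom_right pcomp_hom_left, OF assms(1) refl assms(2)])
    (simp add: assms(3))

lemma insert_two_hom3:
  assumes "x \<in> carrier (grmod P h)" "y \<in> carrier (grmod P f)" "p = h + f + g - 2"
  shows "abelian_group_hom (grmod P g) (grmod P p) (\<lambda>z. insert_two h f g x y z i j)"
  unfolding insert_two_def
  by (intro pcomp_hom_right pcomp_closed[OF assms(1,2)]) (simp_all add: assms(3))

lemma tribrace_hom1:
  assumes "y \<in> carrier (grmod P f)" "z \<in> carrier (grmod P g)" "p = h + f + g - 2"
  shows "abelian_group_hom (grmod P h) (grmod P p) (\<lambda>x. tribrace P h f g x y z)"
  unfolding tribrace_def assms(3)[symmetric]
  by (intro abelian_group_hom_finsum grmod_group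
      abelian_group_hom_compose[OF pcomp_hom_left pcomp_hom_left, OF assms(1) refl assms(2)])
    (simp add: assms(3))

lemma tribrace_hom2:
  assumes "x \<in> carrier (grmod P h)" "z \<in> carrier (grmod P g)" "p = h + f + g - 2"
  shows "abelian_group_hom (grmod P f) (grmod P p) (\<lambda>y. tribrace P h f g x y z)"
  unfolding tribrace_def assms(3)[symmetric]
  by (intro abelian_group_hom_finsum grmod_group
      abelian_group_hom_compose[OF pcomp_hom_right pcomp_hom_left, OF assms(1) refl assms(2)])
    (simp add: assms(3))

lemma tribrace_hom3:
  assumes "x \<in> carrier (grmod P h)" "y \<in> carrier (grmod P f)" "p = h + f + g - 2"
  shows "abelian_group_hom (grmod P g) (grmod P p) (tribrace P h f g x y)"
  unfolding tribrace_def assms(3)[symmetric]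
  by (intro abelian_group_hom_finsum grmod_group pcomp_hom_right pcomp_closed[OF assms(1,2)])
    (simp_all add: assms(3))

lemma tribrace_closed:
  "x \<in> carrier (grmod P h) \<Longrightarrow> y \<in> carrier (grmod P f) \<Longrightarrow> z \<in> carrier (grmod P g) \<Longrightarrow>
    p = h + f + g - 2 \<Longrightarrow> tribrace P h f g x y z \<in> carrier (grmod P p)"
  using abelian_group_hom.hom_closed[OF tribrace_hom3] by blast

end

section \<open>Inserting the multiplication into two composed elements\<close>

locale pre_operad_elements = pre_operad K P
  for K :: "('k, 'r) ring_scheme" and P :: "('k, 'a) pre_operad_data" +
  fixes \<mu> x y z :: 'a and h f g :: int
  assumes deg_nonneg: "0 \<le> h" "0 \<le> f" "0 \<le> g"
    and carr: "\<mu> \<in> carrier (grmod P 2)" "x \<in> carrier (grmod P h)"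
      "y \<in> carrier (grmod P f)" "z \<in> carrier (grmod P g)"
begin

abbreviation L where "L \<equiv> grmod P (h + f + g - 1)"

sublocale L: abelian_group L by (rule grmod_group)

definition xyz where "xyz i j = insert_two h f g x y z i j"

definition xmu_yz where "xmu_yz l i j = insert_two (h + 1) f g (pcomp P h 2 l x \<mu>) y z i j"

lemma xyz_closed: "xyz i j \<in> carrier (grmod P (h + f + g - 2))"
  unfolding xyz_def by (intro insert_two_closed carr) simp

lemma xmu_yz_closed: "xmu_yz l i j \<in> carrier L"
  unfolding xmu_yz_def by (intro insert_two_closed[OF pcomp_closed] carr) simp_all

lemma mu_before_z:
  assumes "0 \<le> i" "i < h" "j < h" "0 \<le> k" "k < j + f - 1"
  shows "pcomp P (h + f + g - 2) 2 k (xyz i j) \<mu> =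
    signed L (g - 1) (pcomp P (h + f) g (j + f) (pcomp P (h + f - 1) 2 k (pcomp P h f i x y) \<mu>) z)"
proof -
  have "pcomp P (h + f + g - 2) 2 k (xyz i j) \<mu> = signed L ((g - 1) * (2 - 1))
      (pcomp P (h + f) g (j + f) (pcomp P (h + f - 1) 2 k (pcomp P h f i x y) \<mu>) z)"
    unfolding xyz_def insert_two_def
    by (rule pcomp_left[OF pcomp_closed[OF carr(2,3) refl]]) (use carr deg_nonneg assms in auto)
  then show ?thesis by simp
qed

text \<open>
  Inserting \<open>\<mu>\<close> into \<open>x \<circ>\<^sub>i y\<close> at the place of the input \<open>l \<noteq> i\<close> of \<open>x\<close>: the inputs of \<open>y\<close> shift this
  place if it lies to the right of \<open>i\<close>, and exchanging \<open>y\<close> and \<open>\<mu>\<close> costs \<open>(-1)\<^bsup>|f|\<^esup>\<close> because \<open>|\<mu>| = 1\<close>.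
\<close>

lemma mu_past_y:
  assumes "0 \<le> i" "i < h" "0 \<le> l" "l < h" "l \<noteq> i"
  shows "pcomp P (h + f - 1) 2 (if i < l then l + f - 1 else l) (pcomp P h f i x y) \<mu> =
    signed (grmod P (h + f)) (f - 1) (pcomp P (h + 1) f (skip l i) (pcomp P h 2 l x \<mu>) y)"
proof (cases "l < i")
  case True
  have "pcomp P (h + f - 1) 2 l (pcomp P h f i x y) \<mu> = signed (grmod P (h + f)) ((f - 1) * (2 - 1))
      (pcomp P (h + 1) f (i + 1) (pcomp P h 2 l x \<mu>) y)"
    by (rule pcomp_left) (use carr deg_nonneg assms True in auto)
  then show ?thesis using True by (simp add: skip_def)
next
  case False
  have "pcomp P (h + f - 1) 2 (l + f - 1) (pcomp P h f i x y) \<mu> =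
      signed (grmod P (h + f)) ((f - 1) * (2 - 1))
        (pcomp P (h + 1) f i (pcomp P h 2 l x \<mu>) y)"
    by (rule pcomp_right) (use carr deg_nonneg assms False in auto)
  then show ?thesis using False assms by (simp add: skip_def)
qed

lemma mu_outside:
  assumes "0 \<le> i" "i < j" "j < h" "0 \<le> l" "l < h" "l \<noteq> i" "l \<noteq> j"
  shows "pcomp P (h + f + g - 2) 2
      (l + (if i < l then f - 1 else 0) + (if j < l then g - 1 else 0)) (xyz i j) \<mu> =
    signed L (f + g) (xmu_yz l (skip l i) (skip l j))"
proof -
  let ?xy = "pcomp P h f i x y" and ?k = "if i < l then l + f - 1 else l"
  let ?u = "pcomp P (h + 1) f (skip l i) (pcomp P h 2 l x \<mu>) y"
  have u: "?u \<in> carrier (grmod P (h + f))"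
    by (intro pcomp_closed[OF pcomp_closed] carr) auto
  have "pcomp P (h + f + g - 2) 2
      (l + (if i < l then f - 1 else 0) + (if j < l then g - 1 else 0)) (xyz i j) \<mu> =
    signed L (g - 1) (pcomp P (h + f) g (skip l j + f - 1) (pcomp P (h + f - 1) 2 ?k ?xy \<mu>) z)"
  proof (cases "l < j")
    case True
    with assms mu_before_z[of i j ?k] deg_nonneg show ?thesis
      by (auto simp: skip_def add_diff_eq split: if_splits)
  next
    case False
    have "pcomp P (h + f + g - 2) 2 (l + f - 1 + (g - 1)) (xyz i j) \<mu> = signed L ((g - 1) * (2 - 1))
        (pcomp P (h + f) g (j + f - 1) (pcomp P (h + f - 1) 2 (l + f - 1) ?xy \<mu>) z)"
      unfolding xyz_def insert_two_def
      by (rule pcomp_right[OF pcomp_closed[OF carr(2,3) refl]])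
        (use carr deg_nonneg assms False in auto)
    with False assms show ?thesis by (simp add: skip_def add_diff_eq)
  qed
  also have "\<dots> = signed L (g - 1) (signed L (f - 1) (pcomp P (h + f) g (skip l j + f - 1) ?u z))"
    using assms by (subst mu_past_y) (auto simp: hom_signed[OF pcomp_hom_left[OF carr(4) refl] u])
  also have "pcomp P (h + f) g (skip l j + f - 1) ?u z = xmu_yz l (skip l i) (skip l j)"
    by (simp add: xmu_yz_def insert_two_def)
  also have "signed L (g - 1) (signed L (f - 1) (xmu_yz l (skip l i) (skip l j))) =
      signed L (f + g) (xmu_yz l (skip l i) (skip l j))"
    by (subst signed_signed) (auto simp: xmu_yz_closed grmod_group intro!: signed_cong)
  finally show ?thesis .
qed

lemma mu_in_y:
  assumes "0 \<le> i" "i < j" "j < h" "0 \<le> t" "t < f"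
  shows "pcomp P (h + f + g - 2) 2 (i + t) (xyz i j) \<mu> =
    signed L (g - 1) (insert_two h (f + 1) g x (pcomp P f 2 t y \<mu>) z i j)"
proof -
  have "pcomp P (h + f - 1) 2 (i + t) (pcomp P h f i x y) \<mu> =
      pcomp P h (f + 1) i x (pcomp P f 2 t y \<mu>)"
    by (rule pcomp_nested) (use carr deg_nonneg assms in auto)
  with mu_before_z[of i j "i + t"] assms show ?thesis by (simp add: insert_two_def algebra_simps)
qed

lemma mu_in_z:
  assumes "0 \<le> i" "i < j" "j < h" "0 \<le> t" "t < g"
  shows "pcomp P (h + f + g - 2) 2 (j + f - 1 + t) (xyz i j) \<mu> =
    insert_two h f (g + 1) x y (pcomp P g 2 t z \<mu>) i j"
  unfolding xyz_def insert_two_def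
  by (rule pcomp_nested[OF pcomp_closed[OF carr(2,3) refl]]) (use carr deg_nonneg assms in auto)

text \<open>
  The inputs of \<open>xyz i j\<close> are those of \<open>y\<close>, those of \<open>z\<close>, and the inputs \<open>l\<close> of \<open>x\<close> other than
  \<open>i\<close> and \<open>j\<close>; the composition with \<open>\<mu>\<close> splits accordingly.
\<close>

lemma total_comp_xyz_mu:
  assumes ij: "0 \<le> i" "i < j" "j < h"
  shows "total_comp P (h + f + g - 2) 2 (xyz i j) \<mu> =
    (\<Oplus>\<^bsub>L\<^esub>l\<in>{0..h - 1} - {i, j}. signed L (f + g) (xmu_yz l (skip l i) (skip l j))) \<oplus>\<^bsub>L\<^esub>
    (signed L (g - 1) (insert_two h (f + 1) g x (total_comp P f 2 y \<mu>) z i j) \<oplus>\<^bsub>L\<^esub>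
    insert_two h f (g + 1) x y (total_comp P g 2 z \<mu>) i j)"
proof -
  let ?u = "\<lambda>k. pcomp P (h + f + g - 2) 2 k (xyz i j) \<mu>"
  let ?S = "{0..h + f + g - 3}" and ?Y = "{i..i + f - 1}" and ?Z = "{j + f - 1..j + f + g - 2}"
  have u: "?u k \<in> carrier L" for k
    by (intro pcomp_closed[OF xyz_closed] carr) simp
  have "total_comp P (h + f + g - 2) 2 (xyz i j) \<mu> = finsum L ?u ?S"
    by (simp add: total_comp_def algebra_simps)
  also have "\<dots> = finsum L ?u (?S - (?Y \<union> ?Z)) \<oplus>\<^bsub>L\<^esub> finsum L ?u (?Y \<union> ?Z)"
    by (rule L.finsum_subset_diff[THEN trans[OF _ L.a_comm]])
      (use u ij deg_nonneg in \<open>auto intro!: L.finsum_closed\<close>)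
  also have "finsum L ?u (?Y \<union> ?Z) = finsum L ?u ?Y \<oplus>\<^bsub>L\<^esub> finsum L ?u ?Z"
    by (rule L.finsum_Un_disjoint) (use u ij in auto)
  also have "finsum L ?u ?Y =
      (\<Oplus>\<^bsub>L\<^esub>t\<in>{0..f - 1}. signed L (g - 1) (insert_two h (f + 1) g x (pcomp P f 2 t y \<mu>) z i j))"
    by (rule L.finsum_bij[symmetric, where b = "\<lambda>t. i + t"])
      (use u ij in \<open>auto simp: mu_in_y intro!: bij_betw_byWitness[where f' = "\<lambda>k. k - i"]\<close>)
  also have "\<dots> = signed L (g - 1) (insert_two h (f + 1) g x (total_comp P f 2 y \<mu>) z i j)"
    by (rule hom_total_comp[symmetric, OF abelian_group_hom_compose[OF
            insert_two_hom2[OF carr(2,4)] signed_hom[OF grmod_group]]]) (simp_all add: carr)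
  also have "finsum L ?u ?Z = (\<Oplus>\<^bsub>L\<^esub>t\<in>{0..g - 1}. insert_two h f (g + 1) x y (pcomp P g 2 t z \<mu>) i j)"
    by (rule L.finsum_bij[symmetric, where b = "\<lambda>t. j + f - 1 + t"])
      (use u ij in \<open>auto simp: mu_in_z intro!: bij_betw_byWitness[where f' = "\<lambda>k. k - (j + f - 1)"]\<close>)
  also have "\<dots> = insert_two h f (g + 1) x y (total_comp P g 2 z \<mu>) i j"
    by (rule hom_total_comp[symmetric, OF insert_two_hom3[OF carr(2,3)]]) (simp_all add: carr)
  \<comment> \<open>The input \<open>l\<close> of \<open>x\<close> is shifted by \<open>|f|\<close> if it lies beyond \<open>y\<close>, and by \<open>|g|\<close> if beyond \<open>z\<close>.\<close>
  also have "finsum L ?u (?S - (?Y \<union> ?Z)) =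
      (\<Oplus>\<^bsub>L\<^esub>l\<in>{0..h - 1} - {i, j}. signed L (f + g) (xmu_yz l (skip l i) (skip l j)))"
    by (rule L.finsum_bij[symmetric,
          where b = "\<lambda>l. l + (if i < l then f - 1 else 0) + (if j < l then g - 1 else 0)"],
        rule bij_betw_byWitness[where
          f' = "\<lambda>k. if k < i then k else if k < j + f - 1 then k - (f - 1) else k - (f - 1) - (g - 1)"])
      (use u ij deg_nonneg in \<open>auto simp: mu_outside split: if_splits\<close>)
  finally show ?thesis .
qed


section \<open>Composition with the multiplication on the right\<close>

abbreviation tri where "tri \<equiv> tribrace P h f g x y z"

lemma tri_closed: "tri \<in> carrier (grmod P (h + f + g - 2))"
  by (intro tribrace_closed carr refl)

lemma tri_eq: "tri = (\<Oplus>\<^bsub>grmod P (h + f + g - 2)\<^esub>q\<in>pairs h. xyz (fst q) (snd q))"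
  unfolding xyz_def by (intro tribrace_pairs carr refl)

lemma hom_tri:
  assumes "abelian_group_hom (grmod P (h + f + g - 2)) H \<phi>"
  shows "\<phi> tri = (\<Oplus>\<^bsub>H\<^esub>q\<in>pairs h. \<phi> (xyz (fst q) (snd q)))"
  unfolding tri_eq by (rule abelian_group_hom.hom_finsum[OF assms]) (auto intro!: xyz_closed)

text \<open>
  The terms of \<open>{x, y, z} \<bullet> \<mu>\<close> and of \<open>{x \<bullet> \<mu>, y, z}\<close> in which \<open>x\<close>, but neither \<open>y\<close> nor \<open>z\<close>, is
  composed with \<open>\<mu>\<close>; they cancel in the derivation deviation.
\<close>

definition mu_apart where
  "mu_apart = (\<Oplus>\<^bsub>L\<^esub>q\<in>pairs h. \<Oplus>\<^bsub>L\<^esub>l\<in>{0..h - 1} - {fst q, snd q}. xmu_yz l (skip l (fst q)) (skip l (snd q)))"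

lemma mu_apart_closed: "mu_apart \<in> carrier L"
  unfolding mu_apart_def by (auto intro!: L.finsum_closed xmu_yz_closed)

lemma tribrace_y_mu:
  "tribrace P h (f + 1) g x (total_comp P f 2 y \<mu>) z =
    (\<Oplus>\<^bsub>L\<^esub>q\<in>pairs h. insert_two h (f + 1) g x (total_comp P f 2 y \<mu>) z (fst q) (snd q))"
  by (rule tribrace_pairs) (auto intro!: carr total_comp_closed)

lemma tribrace_z_mu:
  "tribrace P h f (g + 1) x y (total_comp P g 2 z \<mu>) =
    (\<Oplus>\<^bsub>L\<^esub>q\<in>pairs h. insert_two h f (g + 1) x y (total_comp P g 2 z \<mu>) (fst q) (snd q))"
  by (rule tribrace_pairs) (auto intro!: carr total_comp_closed)

lemma total_comp_tri_mu:
  "total_comp P (h + f + g - 2) 2 tri \<mu> = signed L (f + g) mu_apart \<oplus>\<^bsub>L\<^esub>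
    (signed L (g - 1) (tribrace P h (f + 1) g x (total_comp P f 2 y \<mu>) z) \<oplus>\<^bsub>L\<^esub>
    tribrace P h f (g + 1) x y (total_comp P g 2 z \<mu>))"
proof -
  let ?U = "\<lambda>i j. \<Oplus>\<^bsub>L\<^esub>l\<in>{0..h - 1} - {i, j}. signed L (f + g) (xmu_yz l (skip l i) (skip l j))"
  let ?Y = "\<lambda>i j. insert_two h (f + 1) g x (total_comp P f 2 y \<mu>) z i j"
  let ?Z = "\<lambda>i j. insert_two h f (g + 1) x y (total_comp P g 2 z \<mu>) i j"
  note hom = abelian_group_hom.hom_finsum[OF signed_hom[OF grmod_group]]
  have U: "?U i j \<in> carrier L" for i j
    by (auto intro!: L.finsum_closed signed_closed grmod_group xmu_yz_closed)
  have Y: "?Y i j \<in> carrier L" for i j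
    by (intro insert_two_closed carr total_comp_closed) auto
  have Z: "?Z i j \<in> carrier L" for i j
    by (intro insert_two_closed carr total_comp_closed) auto
  note YZ = Y Z signed_closed[OF grmod_group Y]
  have "total_comp P (h + f + g - 2) 2 tri \<mu> =
      (\<Oplus>\<^bsub>L\<^esub>q\<in>pairs h. total_comp P (h + f + g - 2) 2 (xyz (fst q) (snd q)) \<mu>)"
    by (rule hom_tri[OF total_comp_hom_left[OF carr(1)]]) simp
  also have "\<dots> = (\<Oplus>\<^bsub>L\<^esub>q\<in>pairs h. ?U (fst q) (snd q) \<oplus>\<^bsub>L\<^esub>
      (signed L (g - 1) (?Y (fst q) (snd q)) \<oplus>\<^bsub>L\<^esub> ?Z (fst q) (snd q)))"
    by (rule L.finsum_cong') (use U YZ in \<open>auto simp: pairs_def total_comp_xyz_mu\<close>)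
  also have "\<dots> = (\<Oplus>\<^bsub>L\<^esub>q\<in>pairs h. ?U (fst q) (snd q)) \<oplus>\<^bsub>L\<^esub>
      ((\<Oplus>\<^bsub>L\<^esub>q\<in>pairs h. signed L (g - 1) (?Y (fst q) (snd q))) \<oplus>\<^bsub>L\<^esub>
      (\<Oplus>\<^bsub>L\<^esub>q\<in>pairs h. ?Z (fst q) (snd q)))"
    using U YZ by (simp add: L.finsum_addf)
  also have "(\<Oplus>\<^bsub>L\<^esub>q\<in>pairs h. ?U (fst q) (snd q)) = signed L (f + g) mu_apart"
    unfolding mu_apart_def
    by (simp add: hom xmu_yz_closed L.finsum_closed)
  also have "(\<Oplus>\<^bsub>L\<^esub>q\<in>pairs h. signed L (g - 1) (?Y (fst q) (snd q))) =
      signed L (g - 1) (tribrace P h (f + 1) g x (total_comp P f 2 y \<mu>) z)"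
    unfolding tribrace_y_mu by (simp add: hom Y)
  finally show ?thesis unfolding tribrace_z_mu .
qed

lemma total_comp_two:
  assumes "b \<in> carrier (grmod P n)" "p = n + 1"
  shows "total_comp P 2 n \<mu> b = pcomp P 2 n 0 \<mu> b \<oplus>\<^bsub>grmod P p\<^esub> pcomp P 2 n 1 \<mu> b"
proof -
  interpret M: abelian_group "grmod P p" by (rule grmod_group)
  have cl: "pcomp P 2 n i \<mu> b \<in> carrier (grmod P p)" for i
    by (intro pcomp_closed carr assms) (simp add: assms)
  have "{0..2 - 1} = {0, 1 :: int}" "2 + n - 1 = p" using assms by auto
  then have "total_comp P 2 n \<mu> b = (\<Oplus>\<^bsub>grmod P p\<^esub>i\<in>{0, 1}. pcomp P 2 n i \<mu> b)"
    by (simp only: total_comp_def)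
  then show ?thesis by (simp add: cl)
qed

lemma cup_closed:
  assumes "u \<in> carrier (grmod P a)" "v \<in> carrier (grmod P b)" "p = a + b"
  shows "cup P \<mu> a b u v \<in> carrier (grmod P p)"
  unfolding cup_def assms(3)
  by (intro signed_closed grmod_group pcomp_closed[OF pcomp_closed[OF carr(1) assms(1)]] assms(2)) auto

lemma cup_unsigned:
  assumes "u \<in> carrier (grmod P a)" "v \<in> carrier (grmod P b)" "m = a + 1" "p = a + b"
  shows "pcomp P m b a (pcomp P 2 a 0 \<mu> u) v = signed (grmod P p) a (cup P \<mu> a b u v)"
proof -
  have "pcomp P (a + 1) b a (pcomp P 2 a 0 \<mu> u) v \<in> carrier (grmod P p)"
    by (intro pcomp_closed[OF pcomp_closed[OF carr(1) assms(1)]] assms(2)) (auto simp: assms)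
  then show ?thesis
    unfolding cup_def assms(3,4)[symmetric] by (subst signed_signed) (auto simp: grmod_group signed_def assms)
qed

text \<open>
  Both inputs of \<open>\<mu>\<close> are filled: this is where \<open>y \<smile> z\<close> arises.
\<close>

lemma xmu_yz_both:
  assumes "0 \<le> l" "l < h"
  shows "xmu_yz l l (l + 1) = signed L f (pcomp P h (f + g) l x (cup P \<mu> f g y z))"
proof -
  have my: "pcomp P 2 f 0 \<mu> y \<in> carrier (grmod P (f + 1))"
    by (intro pcomp_closed carr) simp
  have yz: "pcomp P (f + 1) g f (pcomp P 2 f 0 \<mu> y) z \<in> carrier (grmod P (f + g))"
    by (intro pcomp_closed[OF my] carr) simp
  have "xmu_yz l l (l + 1) = pcomp P (h + f) g (l + f) (pcomp P (h + 1) f l (pcomp P h 2 l x \<mu>) y) z"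
    by (simp add: xmu_yz_def insert_two_def add.commute)
  also have "pcomp P (h + 1) f l (pcomp P h 2 l x \<mu>) y = pcomp P h (f + 1) l x (pcomp P 2 f 0 \<mu> y)"
    by (rule pcomp_nested) (use assms deg_nonneg carr in auto)
  also have "pcomp P (h + f) g (l + f) \<dots> z =
      pcomp P h (f + g) l x (pcomp P (f + 1) g f (pcomp P 2 f 0 \<mu> y) z)"
    by (rule pcomp_nested[OF carr(2) my carr(4)]) (use assms deg_nonneg in auto)
  also have "pcomp P (f + 1) g f (pcomp P 2 f 0 \<mu> y) z = signed (grmod P (f + g)) f (cup P \<mu> f g y z)"
    unfolding cup_def by (subst signed_signed) (auto simp: yz grmod_group signed_def)
  also have "pcomp P h (f + g) l x \<dots> = signed L f (pcomp P h (f + g) l x (cup P \<mu> f g y z))"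
    by (rule hom_signed[OF pcomp_hom_right[OF carr(2)]])
      (auto simp: cup_def intro!: signed_closed grmod_group yz)
  finally show ?thesis .
qed

lemma xmu_yz_at_y:
  assumes "0 \<le> i" "i < j" "j < h"
  shows "xmu_yz i i (j + 1) \<oplus>\<^bsub>L\<^esub> xmu_yz i (i + 1) (j + 1) =
    insert_two h (f + 1) g x (total_comp P 2 f \<mu> y) z i j"
proof -
  have "pcomp P (h + 1) f (i + t) (pcomp P h 2 i x \<mu>) y = pcomp P h (f + 1) i x (pcomp P 2 f t \<mu> y)"
    if "t = 0 \<or> t = 1" for t
    by (rule pcomp_nested) (use that assms deg_nonneg carr in auto)
  from this[of 0] this[of 1]
  have "xmu_yz i i (j + 1) = insert_two h (f + 1) g x (pcomp P 2 f 0 \<mu> y) z i j"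
    "xmu_yz i (i + 1) (j + 1) = insert_two h (f + 1) g x (pcomp P 2 f 1 \<mu> y) z i j"
    by (simp_all add: xmu_yz_def insert_two_def algebra_simps)
  moreover have "insert_two h (f + 1) g x (a \<oplus>\<^bsub>grmod P (f + 1)\<^esub> b) z i j =
      insert_two h (f + 1) g x a z i j \<oplus>\<^bsub>L\<^esub> insert_two h (f + 1) g x b z i j"
    if "a \<in> carrier (grmod P (f + 1))" "b \<in> carrier (grmod P (f + 1))" for a b
    by (rule abelian_group_hom.hom_add[OF insert_two_hom2[OF carr(2,4)] that]) simp
  moreover have "pcomp P 2 f t \<mu> y \<in> carrier (grmod P (f + 1))" for t
    by (intro pcomp_closed carr) simp
  ultimately show ?thesis by (simp add: total_comp_two[OF carr(3) refl])
qed

text \<open>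
  Here \<open>y\<close> sits to the left of \<open>\<mu>\<close>; it has to be inserted before \<open>\<mu>\<close> in order that \<open>\<mu>\<close> and \<open>z\<close> can be
  composed with each other, which accounts for the sign.
\<close>

lemma xmu_yz_at_z:
  assumes "0 \<le> i" "i < j" "j < h"
  shows "xmu_yz j i j \<oplus>\<^bsub>L\<^esub> xmu_yz j i (j + 1) =
    signed L (f - 1) (insert_two h f (g + 1) x y (total_comp P 2 g \<mu> z) i j)"
proof -
  let ?xy = "pcomp P h f i x y" and ?hf = "grmod P (h + f)"
  have xy: "?xy \<in> carrier (grmod P (h + f - 1))" by (intro pcomp_closed carr refl)
  have xym: "pcomp P (h + f - 1) 2 k ?xy \<mu> \<in> carrier ?hf" for k
    by (intro pcomp_closed[OF xy] carr) simp
  have "pcomp P (h + f - 1) 2 (j + f - 1) ?xy \<mu> =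
      signed ?hf (f - 1) (pcomp P (h + 1) f i (pcomp P h 2 j x \<mu>) y)"
    using mu_past_y[of i j] assms by (simp add: skip_def)
  then have eq: "pcomp P (h + 1) f i (pcomp P h 2 j x \<mu>) y =
      signed ?hf (f - 1) (pcomp P (h + f - 1) 2 (j + f - 1) ?xy \<mu>)"
    by (auto simp: signed_def intro!: abelian_group.minus_minus[symmetric] grmod_group pcomp_closed carr)
  have "xmu_yz j i (j + t) = signed L (f - 1) (insert_two h f (g + 1) x y (pcomp P 2 g t \<mu> z) i j)"
    if "t = 0 \<or> t = 1" for t
  proof -
    have "xmu_yz j i (j + t) = pcomp P (h + f) g (j + t + f - 1)
        (signed ?hf (f - 1) (pcomp P (h + f - 1) 2 (j + f - 1) ?xy \<mu>)) z"
      by (simp add: xmu_yz_def insert_two_def eq)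
    also have "\<dots> = signed L (f - 1)
        (pcomp P (h + f) g (j + t + f - 1) (pcomp P (h + f - 1) 2 (j + f - 1) ?xy \<mu>) z)"
      by (rule hom_signed[OF pcomp_hom_left[OF carr(4)] xym]) simp
    also have "pcomp P (h + f) g (j + t + f - 1) (pcomp P (h + f - 1) 2 (j + f - 1) ?xy \<mu>) z =
        insert_two h f (g + 1) x y (pcomp P 2 g t \<mu> z) i j"
      unfolding insert_two_def
      by (rule pcomp_nested[OF xy]) (use that carr assms deg_nonneg in auto)
    finally show ?thesis .
  qed
  from this[of 0] this[of 1]
  have "xmu_yz j i j \<oplus>\<^bsub>L\<^esub> xmu_yz j i (j + 1) =
      signed L (f - 1) (insert_two h f (g + 1) x y (pcomp P 2 g 0 \<mu> z) i j) \<oplus>\<^bsub>L\<^esub>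
      signed L (f - 1) (insert_two h f (g + 1) x y (pcomp P 2 g 1 \<mu> z) i j)"
    by simp
  also have "\<dots> = signed L (f - 1) (insert_two h f (g + 1) x y
      (pcomp P 2 g 0 \<mu> z \<oplus>\<^bsub>grmod P (g + 1)\<^esub> pcomp P 2 g 1 \<mu> z) i j)"
    by (rule abelian_group_hom.hom_add[symmetric, OF abelian_group_hom_compose[OF
            insert_two_hom3[OF carr(2,3)] signed_hom[OF grmod_group]]])
      (auto intro!: pcomp_closed carr)
  finally show ?thesis by (simp add: total_comp_two[OF carr(4) refl])
qed

lemma tribrace_x_mu:
  "tribrace P (h + 1) f g (total_comp P h 2 x \<mu>) y z = mu_apart \<oplus>\<^bsub>L\<^esub>
    (signed L f (total_comp P h (f + g) x (cup P \<mu> f g y z)) \<oplus>\<^bsub>L\<^esub>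
    (tribrace P h (f + 1) g x (total_comp P 2 f \<mu> y) z \<oplus>\<^bsub>L\<^esub>
    signed L (f - 1) (tribrace P h f (g + 1) x y (total_comp P 2 g \<mu> z))))"
proof -
  note hom = abelian_group_hom.hom_finsum[OF signed_hom[OF grmod_group]]
  have cup: "cup P \<mu> f g y z \<in> carrier (grmod P (f + g))"
    unfolding cup_def
    by (intro signed_closed grmod_group pcomp_closed[OF pcomp_closed[OF carr(1,3)]] carr) auto
  have "tribrace P (h + 1) f g (total_comp P h 2 x \<mu>) y z =
      (\<Oplus>\<^bsub>L\<^esub>l\<in>{0..h - 1}. tribrace P (h + 1) f g (pcomp P h 2 l x \<mu>) y z)"
    by (rule hom_total_comp[OF tribrace_hom1[OF carr(3,4)]]) (simp_all add: carr)
  also have "\<dots> = (\<Oplus>\<^bsub>L\<^esub>l\<in>{0..h - 1}. \<Oplus>\<^bsub>L\<^esub>q\<in>pairs (h + 1). xmu_yz l (fst q) (snd q))"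
    unfolding xmu_yz_def
    by (intro L.finsum_cong' tribrace_pairs refl)
      (auto intro!: L.finsum_closed insert_two_closed[OF pcomp_closed] pcomp_closed carr)
  also have "\<dots> = mu_apart \<oplus>\<^bsub>L\<^esub> ((\<Oplus>\<^bsub>L\<^esub>l\<in>{0..h - 1}. xmu_yz l l (l + 1)) \<oplus>\<^bsub>L\<^esub>
      ((\<Oplus>\<^bsub>L\<^esub>q\<in>pairs h. xmu_yz (fst q) (fst q) (snd q + 1) \<oplus>\<^bsub>L\<^esub> xmu_yz (fst q) (fst q + 1) (snd q + 1)) \<oplus>\<^bsub>L\<^esub>
      (\<Oplus>\<^bsub>L\<^esub>q\<in>pairs h. xmu_yz (snd q) (fst q) (snd q) \<oplus>\<^bsub>L\<^esub> xmu_yz (snd q) (fst q) (snd q + 1))))"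
    unfolding mu_apart_def by (rule L.finsum_pairs_double) (rule xmu_yz_closed)
  also have "(\<Oplus>\<^bsub>L\<^esub>l\<in>{0..h - 1}. xmu_yz l l (l + 1)) =
      (\<Oplus>\<^bsub>L\<^esub>l\<in>{0..h - 1}. signed L f (pcomp P h (f + g) l x (cup P \<mu> f g y z)))"
    by (rule L.finsum_cong')
      (auto simp: xmu_yz_both intro!: signed_closed grmod_group pcomp_closed carr cup)
  also have "\<dots> = signed L f (total_comp P h (f + g) x (cup P \<mu> f g y z))"
    by (rule hom_total_comp[symmetric, OF signed_hom[OF grmod_group]]) (simp_all add: carr cup)
  also have "(\<Oplus>\<^bsub>L\<^esub>q\<in>pairs h. xmu_yz (fst q) (fst q) (snd q + 1) \<oplus>\<^bsub>L\<^esub> xmu_yz (fst q) (fst q + 1) (snd q + 1)) =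
      (\<Oplus>\<^bsub>L\<^esub>q\<in>pairs h. insert_two h (f + 1) g x (total_comp P 2 f \<mu> y) z (fst q) (snd q))"
    by (rule L.finsum_cong')
      (auto simp: xmu_yz_at_y pairs_def intro!: insert_two_closed total_comp_closed carr)
  also have "\<dots> = tribrace P h (f + 1) g x (total_comp P 2 f \<mu> y) z"
    by (rule tribrace_pairs[symmetric]) (auto intro!: total_comp_closed carr)
  also have "(\<Oplus>\<^bsub>L\<^esub>q\<in>pairs h. xmu_yz (snd q) (fst q) (snd q) \<oplus>\<^bsub>L\<^esub> xmu_yz (snd q) (fst q) (snd q + 1)) =
      (\<Oplus>\<^bsub>L\<^esub>q\<in>pairs h. signed L (f - 1)
        (insert_two h f (g + 1) x y (total_comp P 2 g \<mu> z) (fst q) (snd q)))"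
    by (rule L.finsum_cong')
      (auto simp: xmu_yz_at_z pairs_def intro!: signed_closed grmod_group insert_two_closed total_comp_closed carr)
  also have "\<dots> = signed L (f - 1)
      (\<Oplus>\<^bsub>L\<^esub>q\<in>pairs h. insert_two h f (g + 1) x y (total_comp P 2 g \<mu> z) (fst q) (snd q))"
    by (rule hom[symmetric]) (auto intro!: insert_two_closed total_comp_closed carr)
  also have "(\<Oplus>\<^bsub>L\<^esub>q\<in>pairs h. insert_two h f (g + 1) x y (total_comp P 2 g \<mu> z) (fst q) (snd q)) =
      tribrace P h f (g + 1) x y (total_comp P 2 g \<mu> z)"
    by (rule tribrace_pairs[symmetric]) (auto intro!: total_comp_closed carr)
  finally show ?thesis .
qed


section \<open>Composition with the multiplication on the left\<close>

text \<open>
  In \<open>\<mu> \<circ>\<^sub>0 x\<close> the only input outside \<open>x\<close> is the last one.  If \<open>z\<close> fills it, then \<open>\<mu>\<close> multiplies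
  \<open>x \<circ>\<^sub>i y\<close> with \<open>z\<close>; otherwise \<open>y\<close> and \<open>z\<close> are both inserted into \<open>x\<close>.
\<close>

lemma tribrace_mu_x_first:
  "tribrace P (h + 1) f g (pcomp P 2 h 0 \<mu> x) y z =
    pcomp P 2 (h + f + g - 2) 0 \<mu> tri \<oplus>\<^bsub>L\<^esub>
    signed L (h + f - 1) (cup P \<mu> (h + f - 1) g (total_comp P h f x y) z)"
proof -
  let ?v = "\<lambda>i j. insert_two (h + 1) f g (pcomp P 2 h 0 \<mu> x) y z i j"
  let ?hf = "grmod P (h + f - 1)"
  have mx: "pcomp P 2 h 0 \<mu> x \<in> carrier (grmod P (h + 1))" by (intro pcomp_closed carr) simp
  have xy: "pcomp P h f i x y \<in> carrier ?hf" for i by (intro pcomp_closed carr refl)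
  have v: "?v i j \<in> carrier L" for i j by (intro insert_two_closed mx carr) simp
  have last_closed: "pcomp P (h + f) g (h + f - 1) (pcomp P 2 (h + f - 1) 0 \<mu> (pcomp P h f i x y)) z
      \<in> carrier L" for i
    by (intro pcomp_closed[OF pcomp_closed[OF carr(1) xy] carr(4)]) auto
  have in_x: "pcomp P (h + 1) f i (pcomp P 2 h 0 \<mu> x) y = pcomp P 2 (h + f - 1) 0 \<mu> (pcomp P h f i x y)"
    if "0 \<le> i" "i < h" for i
    by (rule pcomp_nested) (use that deg_nonneg carr in auto)
  have "tribrace P (h + 1) f g (pcomp P 2 h 0 \<mu> x) y z = (\<Oplus>\<^bsub>L\<^esub>q\<in>pairs (h + 1). ?v (fst q) (snd q))"
    by (rule tribrace_pairs) (simp_all add: carr mx)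
  also have "\<dots> = (\<Oplus>\<^bsub>L\<^esub>q\<in>pairs h. ?v (fst q) (snd q)) \<oplus>\<^bsub>L\<^esub> (\<Oplus>\<^bsub>L\<^esub>i\<in>{0..h - 1}. ?v i h)"
    by (rule L.finsum_pairs_last) (rule v)
  also have "(\<Oplus>\<^bsub>L\<^esub>q\<in>pairs h. ?v (fst q) (snd q)) =
      (\<Oplus>\<^bsub>L\<^esub>q\<in>pairs h. pcomp P 2 (h + f + g - 2) 0 \<mu> (xyz (fst q) (snd q)))"
  proof (rule L.finsum_cong')
    fix q assume "q \<in> pairs h"
    then obtain i j where q: "q = (i, j)" "0 \<le> i" "i < j" "j < h" by (auto simp: pairs_def)
    have "pcomp P (h + f) g (j + f - 1) (pcomp P 2 (h + f - 1) 0 \<mu> (pcomp P h f i x y)) z =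
        pcomp P 2 (h + f + g - 2) 0 \<mu> (xyz i j)"
      unfolding xyz_def insert_two_def
      by (rule pcomp_nested[OF carr(1) xy carr(4)]) (use q deg_nonneg in auto)
    then show "?v (fst q) (snd q) = pcomp P 2 (h + f + g - 2) 0 \<mu> (xyz (fst q) (snd q))"
      using q in_x by (simp add: insert_two_def)
  qed (auto intro!: pcomp_closed carr xyz_closed)
  also have "\<dots> = pcomp P 2 (h + f + g - 2) 0 \<mu> tri"
    by (rule hom_tri[symmetric, OF pcomp_hom_right[OF carr(1)]]) simp
  also have "(\<Oplus>\<^bsub>L\<^esub>i\<in>{0..h - 1}. ?v i h) = (\<Oplus>\<^bsub>L\<^esub>i\<in>{0..h - 1}.
      pcomp P (h + f) g (h + f - 1) (pcomp P 2 (h + f - 1) 0 \<mu> (pcomp P h f i x y)) z)"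
    by (rule L.finsum_cong')
      (auto simp: insert_two_def in_x last_closed)
  also have "\<dots> = pcomp P (h + f) g (h + f - 1) (pcomp P 2 (h + f - 1) 0 \<mu> (total_comp P h f x y)) z"
    by (rule hom_total_comp[symmetric, OF abelian_group_hom_compose[OF
            pcomp_hom_right[OF carr(1)] pcomp_hom_left[OF carr(4)]]]) (simp_all add: carr)
  also have "\<dots> = signed L (h + f - 1) (cup P \<mu> (h + f - 1) g (total_comp P h f x y) z)"
    by (rule cup_unsigned) (auto intro!: total_comp_closed carr)
  finally show ?thesis .
qed

text \<open>
  In \<open>\<mu> \<circ>\<^sub>1 x\<close> the only input outside \<open>x\<close> is the first one.  If \<open>y\<close> fills it, then it precedes \<open>x\<close>, and
  exchanging \<open>x\<close> and \<open>y\<close> gives the sign \<open>(-1)\<^bsup>|h||f|\<^esup>\<close>.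
\<close>

lemma tribrace_mu_x_second:
  "tribrace P (h + 1) f g (pcomp P 2 h 1 \<mu> x) y z =
    pcomp P 2 (h + f + g - 2) 1 \<mu> tri \<oplus>\<^bsub>L\<^esub>
    signed L ((h - 1) * (f - 1) + f) (cup P \<mu> f (h + g - 1) y (total_comp P h g x z))"
proof -
  let ?v = "\<lambda>i j. insert_two (h + 1) f g (pcomp P 2 h 1 \<mu> x) y z i j"
  let ?hf = "grmod P (h + f - 1)" and ?s = "(h - 1) * (f - 1)"
  have mx: "pcomp P 2 h 1 \<mu> x \<in> carrier (grmod P (h + 1))" by (intro pcomp_closed carr) simp
  have my: "pcomp P 2 f 0 \<mu> y \<in> carrier (grmod P (f + 1))" by (intro pcomp_closed carr) simp
  have xy: "pcomp P h f i x y \<in> carrier ?hf" for i by (intro pcomp_closed carr refl)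
  have v: "?v i j \<in> carrier L" for i j by (intro insert_two_closed mx carr) simp
  have "tribrace P (h + 1) f g (pcomp P 2 h 1 \<mu> x) y z = (\<Oplus>\<^bsub>L\<^esub>q\<in>pairs (h + 1). ?v (fst q) (snd q))"
    by (rule tribrace_pairs) (simp_all add: carr mx)
  also have "\<dots> = (\<Oplus>\<^bsub>L\<^esub>q\<in>pairs h. ?v (fst q + 1) (snd q + 1)) \<oplus>\<^bsub>L\<^esub> (\<Oplus>\<^bsub>L\<^esub>j\<in>{0..h - 1}. ?v 0 (j + 1))"
    by (rule L.finsum_pairs_first) (rule v)
  also have "(\<Oplus>\<^bsub>L\<^esub>q\<in>pairs h. ?v (fst q + 1) (snd q + 1)) =
      (\<Oplus>\<^bsub>L\<^esub>q\<in>pairs h. pcomp P 2 (h + f + g - 2) 1 \<mu> (xyz (fst q) (snd q)))"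
  proof (rule L.finsum_cong')
    fix q assume "q \<in> pairs h"
    then obtain i j where q: "q = (i, j)" "0 \<le> i" "i < j" "j < h" by (auto simp: pairs_def)
    have 1: "pcomp P (h + 1) f (i + 1) (pcomp P 2 h 1 \<mu> x) y = pcomp P 2 (h + f - 1) 1 \<mu> (pcomp P h f i x y)"
      by (rule pcomp_nested) (use q deg_nonneg carr in auto)
    have "pcomp P (h + f) g (j + f) (pcomp P 2 (h + f - 1) 1 \<mu> (pcomp P h f i x y)) z =
        pcomp P 2 (h + f + g - 2) 1 \<mu> (xyz i j)"
      unfolding xyz_def insert_two_def
      by (rule pcomp_nested[OF carr(1) xy carr(4)]) (use q deg_nonneg in auto)
    with 1 show "?v (fst q + 1) (snd q + 1) = pcomp P 2 (h + f + g - 2) 1 \<mu> (xyz (fst q) (snd q))"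
      using q by (simp add: insert_two_def)
  qed (auto intro!: pcomp_closed carr xyz_closed)
  also have "\<dots> = pcomp P 2 (h + f + g - 2) 1 \<mu> tri"
    by (rule hom_tri[symmetric, OF pcomp_hom_right[OF carr(1)]]) simp
  also have "(\<Oplus>\<^bsub>L\<^esub>j\<in>{0..h - 1}. ?v 0 (j + 1)) = (\<Oplus>\<^bsub>L\<^esub>j\<in>{0..h - 1}.
      signed L ?s (pcomp P (f + 1) (h + g - 1) f (pcomp P 2 f 0 \<mu> y) (pcomp P h g j x z)))"
  proof (rule L.finsum_cong')
    fix j assume j: "j \<in> {0..h - 1}"
    have cl: "pcomp P (f + 1) h f (pcomp P 2 f 0 \<mu> y) x \<in> carrier (grmod P (h + f))"
      by (intro pcomp_closed my carr) simp
    have "?v 0 (j + 1) = pcomp P (h + f) g (j + f) (pcomp P (h + 1) f 0 (pcomp P 2 h 1 \<mu> x) y) z"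
      by (simp add: insert_two_def add.commute)
    also have "pcomp P (h + 1) f 0 (pcomp P 2 h 1 \<mu> x) y =
        signed (grmod P (h + f)) ?s (pcomp P (f + 1) h f (pcomp P 2 f 0 \<mu> y) x)"
      by (rule pcomp_left) (use deg_nonneg carr in auto)
    also have "pcomp P (h + f) g (j + f) \<dots> z =
        signed L ?s (pcomp P (h + f) g (j + f) (pcomp P (f + 1) h f (pcomp P 2 f 0 \<mu> y) x) z)"
      by (rule hom_signed[OF pcomp_hom_left[OF carr(4)] cl]) simp
    also have "pcomp P (h + f) g (j + f) (pcomp P (f + 1) h f (pcomp P 2 f 0 \<mu> y) x) z =
        pcomp P (f + 1) (h + g - 1) f (pcomp P 2 f 0 \<mu> y) (pcomp P h g j x z)"
      by (rule pcomp_nested[OF my carr(2,4)]) (use j deg_nonneg in auto)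
    finally show "?v 0 (j + 1) =
      signed L ?s (pcomp P (f + 1) (h + g - 1) f (pcomp P 2 f 0 \<mu> y) (pcomp P h g j x z))" .
  qed (auto intro!: signed_closed grmod_group pcomp_closed[OF my pcomp_closed[OF carr(2,4) refl]])
  also have "\<dots> = signed L ?s
      (pcomp P (f + 1) (h + g - 1) f (pcomp P 2 f 0 \<mu> y) (total_comp P h g x z))"
    by (rule hom_total_comp[symmetric, OF abelian_group_hom_compose[OF
            pcomp_hom_right[OF my] signed_hom[OF grmod_group]]]) (simp_all add: carr)
  also have "pcomp P (f + 1) (h + g - 1) f (pcomp P 2 f 0 \<mu> y) (total_comp P h g x z) =
      signed L f (cup P \<mu> f (h + g - 1) y (total_comp P h g x z))"
    by (rule cup_unsigned) (auto intro!: total_comp_closed carr)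
  also have "signed L ?s \<dots> = signed L (?s + f) (cup P \<mu> f (h + g - 1) y (total_comp P h g x z))"
    by (intro signed_signed grmod_group cup_closed total_comp_closed carr) auto
  finally show ?thesis .
qed


lemma tribrace_mu_x:
  "tribrace P (h + 1) f g (total_comp P 2 h \<mu> x) y z =
    total_comp P 2 (h + f + g - 2) \<mu> tri \<oplus>\<^bsub>L\<^esub>
    (signed L (h + f - 1) (cup P \<mu> (h + f - 1) g (total_comp P h f x y) z) \<oplus>\<^bsub>L\<^esub>
    signed L ((h - 1) * (f - 1) + f) (cup P \<mu> f (h + g - 1) y (total_comp P h g x z)))"
proof -
  have "tribrace P (h + 1) f g (total_comp P 2 h \<mu> x) y z =
      tribrace P (h + 1) f g (pcomp P 2 h 0 \<mu> x) y z \<oplus>\<^bsub>L\<^esub> tribrace P (h + 1) f g (pcomp P 2 h 1 \<mu> x) y z"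
    unfolding total_comp_two[OF carr(2) refl]
    by (rule abelian_group_hom.hom_add[OF tribrace_hom1[OF carr(3,4)]]) (auto intro!: pcomp_closed carr)
  moreover have "total_comp P 2 (h + f + g - 2) \<mu> tri =
      pcomp P 2 (h + f + g - 2) 0 \<mu> tri \<oplus>\<^bsub>L\<^esub> pcomp P 2 (h + f + g - 2) 1 \<mu> tri"
    by (rule total_comp_two[OF tri_closed]) simp
  moreover have "pcomp P 2 (h + f + g - 2) i \<mu> tri \<in> carrier L" for i
    by (intro pcomp_closed carr tri_closed) simp
  moreover have "signed L n (cup P \<mu> (h + f - 1) g (total_comp P h f x y) z) \<in> carrier L"
    "signed L n (cup P \<mu> f (h + g - 1) y (total_comp P h g x z)) \<in> carrier L" for n
    by (auto intro!: signed_closed grmod_group cup_closed total_comp_closed carr)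
  ultimately show ?thesis
    unfolding tribrace_mu_x_first tribrace_mu_x_second by (simp add: L.a_ac)
qed

section \<open>The derivation deviation\<close>

lemma hom_pre_coboundary:
  assumes "abelian_group_hom (grmod P (n + 1)) H \<phi>" "u \<in> carrier (grmod P n)"
  shows "\<phi> (pre_coboundary P \<mu> n u) =
    \<ominus>\<^bsub>H\<^esub> (\<phi> (total_comp P n 2 u \<mu>) \<ominus>\<^bsub>H\<^esub> signed H (n - 1) (\<phi> (total_comp P 2 n \<mu> u)))"
proof -
  interpret abelian_group_hom "grmod P (n + 1)" H \<phi> by fact
  have "total_comp P n 2 u \<mu> \<in> carrier (grmod P (n + 1))" "total_comp P 2 n \<mu> u \<in> carrier (grmod P (n + 1))"
    by (auto intro!: total_comp_closed carr assms)
  then show ?thesis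
    unfolding pre_coboundary_def
    by (simp add: a_minus_def hom_signed[OF assms(1)] signed_closed[OF grmod_group])
qed

lemma tribrace_dev_formula:
  "signed L (g - 1) (tribrace_dev P \<mu> h f g x y z) =
    cup P \<mu> (h + f - 1) g (total_comp P h f x y) z \<oplus>\<^bsub>L\<^esub>
    signed L ((h - 1) * f) (cup P \<mu> f (h + g - 1) y (total_comp P h g x z)) \<ominus>\<^bsub>L\<^esub>
    total_comp P h (f + g) x (cup P \<mu> f g y z)"
proof -
  have deg: "h + f + g - 2 + 1 = h + f + g - 1" by simp
  have "abelian_group_hom (grmod P (h + f + g - 2 + 1)) L (\<lambda>u. u)"
    unfolding deg by (rule abelian_group_hom_additiveI[OF grmod_group grmod_group]) simp_all
  moreover have "abelian_group_hom (grmod P (g + 1)) L (tribrace P h f (g + 1) x y)"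
    by (rule tribrace_hom3[OF carr(2,3)]) simp
  moreover have "abelian_group_hom (grmod P (f + 1)) L (\<lambda>u. tribrace P h (f + 1) g x u z)"
    by (rule tribrace_hom2[OF carr(2,4)]) simp
  moreover have "abelian_group_hom (grmod P (h + 1)) L (\<lambda>u. tribrace P (h + 1) f g u y z)"
    by (rule tribrace_hom1[OF carr(3,4)]) simp
  ultimately have \<delta>:
    "pre_coboundary P \<mu> (h + f + g - 2) tri =
      \<ominus>\<^bsub>L\<^esub> (total_comp P (h + f + g - 2) 2 tri \<mu> \<ominus>\<^bsub>L\<^esub>
        signed L (h + f + g - 2 - 1) (total_comp P 2 (h + f + g - 2) \<mu> tri))"
    "tribrace P h f (g + 1) x y (pre_coboundary P \<mu> g z) =
      \<ominus>\<^bsub>L\<^esub> (tribrace P h f (g + 1) x y (total_comp P g 2 z \<mu>) \<ominus>\<^bsub>L\<^esub>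
        signed L (g - 1) (tribrace P h f (g + 1) x y (total_comp P 2 g \<mu> z)))"
    "tribrace P h (f + 1) g x (pre_coboundary P \<mu> f y) z =
      \<ominus>\<^bsub>L\<^esub> (tribrace P h (f + 1) g x (total_comp P f 2 y \<mu>) z \<ominus>\<^bsub>L\<^esub>
        signed L (f - 1) (tribrace P h (f + 1) g x (total_comp P 2 f \<mu> y) z))"
    "tribrace P (h + 1) f g (pre_coboundary P \<mu> h x) y z =
      \<ominus>\<^bsub>L\<^esub> (tribrace P (h + 1) f g (total_comp P h 2 x \<mu>) y z \<ominus>\<^bsub>L\<^esub>
        signed L (h - 1) (tribrace P (h + 1) f g (total_comp P 2 h \<mu> x) y z))"
    using tri_closed carr by (blast dest: hom_pre_coboundary)+
  show ?thesis
    unfolding tribrace_dev_def Let_def \<delta>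
    by (rule deviation_signs[OF grmod_group _ _ _ _ _ _ _ _ _ total_comp_tri_mu tribrace_x_mu tribrace_mu_x])
      (auto intro!: mu_apart_closed tribrace_closed total_comp_closed cup_closed tri_closed carr)
qed

end

theorem mainTheorem1:
  fixes K :: "('k, 'r) ring_scheme"
    and P :: "('k, 'a) pre_operad_data"
    and \<mu> x y z :: 'a
    and h f g :: nat
  assumes "pre_operad K P"
    and "\<mu> \<in> carrier (comp_mod P 2)"
    and "x \<in> carrier (comp_mod P h)"
    and "y \<in> carrier (comp_mod P f)"
    and "z \<in> carrier (comp_mod P g)"
  shows "signed (grmod P (int h + int f + int g - 1)) (int g - 1)
      (tribrace_dev P \<mu> (int h) (int f) (int g) x y z) =
    cup P \<mu> (int h + int f - 1) (int g) (total_comp P (int h) (int f) x y) z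
    \<oplus>\<^bsub>grmod P (int h + int f + int g - 1)\<^esub>
      signed (grmod P (int h + int f + int g - 1)) ((int h - 1) * int f)
        (cup P \<mu> (int f) (int h + int g - 1) y (total_comp P (int h) (int g) x z))
    \<ominus>\<^bsub>grmod P (int h + int f + int g - 1)\<^esub>
      total_comp P (int h) (int f + int g) x (cup P \<mu> (int f) (int g) y z)"
proof -
  interpret pre_operad K P by fact
  interpret pre_operad_elements K P \<mu> x y z "int h" "int f" "int g"
    by unfold_locales (use assms in \<open>simp_all add: grmod_def\<close>)
  show ?thesis by (rule tribrace_dev_formula)
qed

end
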